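(* On the Sierpinski gasket $SG$, for each $j\ge0$ the set $\{P_{j3}^{(0)},P_{j3}^{(1)},P_{j3}^{(2)}\}$ forms a tight frame for its two-dimensional span $\mathcal F_j=\mathrm{span}\{P_{j3}^{(0)},P_{j3}^{(1)},P_{j3}^{(2)}\}\subset L^2(SG,\mu)$, with frame bound $A_j=\tfrac32\|P_{j3}^{(0)}\|_{L^2}^2$. That is, $\dim\mathcal F_j=2$ and for every $P\in\mathcal F_j$, $$\sum_{n=0}^2\langle P,P_{j3}^{(n)}\rangle^2=A_j\,\|P\|_{L^2}^2.$$
   Context: Sierpinski gasket: let $q_0,q_1,q_2$ be the vertices of an equilateral triangle in $\mathbb{R}^2$ (indices mod 3), $F_i(x)=\tfrac12(x-q_i)+q_i$, and $SG$ the nonempty compact set with $SG=\bigcup_{i=0}^2F_i(SG)$. For a word $w=(w_1,\dots,w_m)$, $F_w=F_{w_1}\circ\cdots\circ F_{w_m}$ and $F_w(SG)$ is a cell of level $m$. $V_0=\{q_0,q_1,q_2\}$ is the boundary, $V_m=\bigcup_iF_iV_{m-1}$, $V_*=\bigcup_mV_m$; for distinct $x,y\in V_m$, $x\sim_m y$ iff $x,y$ lie in a common cell of level $m$. $\mu$ is the probability measure on $SG$ giving mass $3^{-m}$ to each cell of level $m$; all functions are real-valued, $\langle f,g\rangle=\int_{SG}fg\,d\mu$ and $\|f\|_{L^2}^2=\langle f,f\rangle$. Laplacian: $\Delta u(x)=\lim_{m\to\infty}\tfrac32 5^m\sum_{y\sim_m x}(u(y)-u(x))$ for $x\in V_*\setminus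 V_0$; a continuous $u$ is in the domain with $\Delta u=f$ ($f$ continuous on $SG$) if these limits converge uniformly to $f$ on $V_*\setminus V_0$. Derivatives at boundary points: $\partial_nu(q_i)=\lim_m(5/3)^m\big(2u(q_i)-u(F_i^mq_{i+1})-u(F_i^mq_{i-1})\big)$ and $\partial_Tu(q_i)=\lim_m5^m\big(u(F_i^mq_{i+1})-u(F_i^mq_{i-1})\big)$. For $n\in\{0,1,2\}$ and $j\ge0$, $P_{j3}^{(n)}$ is the unique function with $\Delta^{j+1}P_{j3}^{(n)}=0$ and, for $0\le m\le j$, $\Delta^mP_{j3}^{(n)}(q_n)=0$, (normal derivative) $\partial_n\Delta^mP_{j3}^{(n)}(q_n)=0$, $\partial_T\Delta^mP_{j3}^{(n)}(q_n)=\delta_{m,j}$. *)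

theory Defs
  imports "HOL-Analysis.Analysis" "HOL-Library.Function_Algebras"
begin

text \<open>Vertices are indexed by the three-element numeral type \<open>3\<close>, whose arithmetic is
  arithmetic modulo 3.\<close>

definition equilateral :: "(3 \<Rightarrow> real^2) \<Rightarrow> bool" where
  "equilateral q \<longleftrightarrow> (\<exists>s>0. \<forall>i j. i \<noteq> j \<longrightarrow> dist (q i) (q j) = s)"

definition contr :: "(3 \<Rightarrow> real^2) \<Rightarrow> 3 \<Rightarrow> real^2 \<Rightarrow> real^2" where
  "contr q i x = (1/2) *\<^sub>R (x - q i) + q i"

definition contr_word :: "(3 \<Rightarrow> real^2) \<Rightarrow> 3 list \<Rightarrow> real^2 \<Rightarrow> real^2" where
  "contr_word q w = foldr (\<lambda>i g. contr q i \<circ> g) w id"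

definition is_gasket :: "(3 \<Rightarrow> real^2) \<Rightarrow> (real^2) set \<Rightarrow> bool" where
  "is_gasket q K \<longleftrightarrow> compact K \<and> K \<noteq> {} \<and> K = (\<Union>i. contr q i ` K)"

definition is_gasket_measure :: "(3 \<Rightarrow> real^2) \<Rightarrow> (real^2) set \<Rightarrow> (real^2) measure \<Rightarrow> bool" where
  "is_gasket_measure q K \<mu> \<longleftrightarrow>
     sets \<mu> = sets (restrict_space borel K) \<and> emeasure \<mu> (space \<mu>) = 1 \<and>
     (\<forall>w. measure \<mu> (contr_word q w ` K) = (1/3) ^ length w)"

primrec vertices :: "(3 \<Rightarrow> real^2) \<Rightarrow> nat \<Rightarrow> (real^2) set" where
  "vertices q 0 = range q"
| "vertices q (Suc m) = (\<Union>i. contr q i ` vertices q m)"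

definition neighbours :: "(3 \<Rightarrow> real^2) \<Rightarrow> (real^2) set \<Rightarrow> nat \<Rightarrow> real^2 \<Rightarrow> (real^2) set" where
  "neighbours q K m x =
     {y. x \<in> vertices q m \<and> y \<in> vertices q m \<and> x \<noteq> y \<and>
         (\<exists>w. length w = m \<and> x \<in> contr_word q w ` K \<and> y \<in> contr_word q w ` K)}"

text \<open>Functions on the gasket \<open>K\<close> are represented by functions on the plane that vanish off \<open>K\<close>,
  so that equality of functions is equality on \<open>K\<close>.\<close>

definition on_gasket :: "(real^2) set \<Rightarrow> (real^2 \<Rightarrow> real) \<Rightarrow> bool" where
  "on_gasket K u \<longleftrightarrow> (\<forall>x. x \<notin> K \<longrightarrow> u x = 0)"

definition graph_laplacian ::
    "(3 \<Rightarrow> real^2) \<Rightarrow> (real^2) set \<Rightarrow> nat \<Rightarrow> (real^2 \<Rightarrow> real) \<Rightarrow> real^2 \<Rightarrow> real" where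
  "graph_laplacian q K m u x = 3/2 * 5 ^ m * (\<Sum>y\<in>neighbours q K m x. u y - u x)"

text \<open>The difference quotient of level \<open>m\<close> at \<open>x\<close> is meaningful only once \<open>x \<in> V\<^sub>m\<close>. Uniform
  convergence on \<open>V\<^sub>* - V\<^sub>0\<close> therefore bounds the error at level \<open>m\<close> over \<open>V\<^sub>m - V\<^sub>0\<close>; using
  \<^const>\<open>uniform_limit\<close> on all of \<open>V\<^sub>* - V\<^sub>0\<close> would let the points outside \<open>V\<^sub>m\<close>, where the sum is
  empty, force \<open>f = 0\<close>.\<close>

definition has_laplacian ::
    "(3 \<Rightarrow> real^2) \<Rightarrow> (real^2) set \<Rightarrow> (real^2 \<Rightarrow> real) \<Rightarrow> (real^2 \<Rightarrow> real) \<Rightarrow> bool" where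
  "has_laplacian q K u f \<longleftrightarrow>
     on_gasket K u \<and> continuous_on K u \<and> on_gasket K f \<and> continuous_on K f \<and>
     (\<forall>e>0. \<exists>N. \<forall>m\<ge>N. \<forall>x\<in>vertices q m - vertices q 0.
        \<bar>graph_laplacian q K m u x - f x\<bar> < e)"

definition in_dom_laplacian :: "(3 \<Rightarrow> real^2) \<Rightarrow> (real^2) set \<Rightarrow> (real^2 \<Rightarrow> real) \<Rightarrow> bool" where
  "in_dom_laplacian q K u \<longleftrightarrow> (\<exists>f. has_laplacian q K u f)"

definition laplacian ::
    "(3 \<Rightarrow> real^2) \<Rightarrow> (real^2) set \<Rightarrow> (real^2 \<Rightarrow> real) \<Rightarrow> real^2 \<Rightarrow> real" where
  "laplacian q K u = (THE f. has_laplacian q K u f)"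

definition has_normal_deriv ::
    "(3 \<Rightarrow> real^2) \<Rightarrow> (real^2 \<Rightarrow> real) \<Rightarrow> real \<Rightarrow> 3 \<Rightarrow> bool" where
  "has_normal_deriv q u d i \<longleftrightarrow>
     (\<lambda>m. (5/3) ^ m * (2 * u (q i) - u ((contr q i ^^ m) (q (i + 1)))
                                   - u ((contr q i ^^ m) (q (i - 1))))) \<longlonglongrightarrow> d"

definition has_tangential_deriv ::
    "(3 \<Rightarrow> real^2) \<Rightarrow> (real^2 \<Rightarrow> real) \<Rightarrow> real \<Rightarrow> 3 \<Rightarrow> bool" where
  "has_tangential_deriv q u d i \<longleftrightarrow>
     (\<lambda>m. 5 ^ m * (u ((contr q i ^^ m) (q (i + 1))) - u ((contr q i ^^ m) (q (i - 1))))) \<longlonglongrightarrow> d"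

definition is_monomial3 ::
    "(3 \<Rightarrow> real^2) \<Rightarrow> (real^2) set \<Rightarrow> nat \<Rightarrow> 3 \<Rightarrow> (real^2 \<Rightarrow> real) \<Rightarrow> bool" where
  "is_monomial3 q K j n p \<longleftrightarrow>
     (\<forall>m\<le>j. in_dom_laplacian q K ((laplacian q K ^^ m) p)) \<and>
     (laplacian q K ^^ (j + 1)) p = (\<lambda>x. 0) \<and>
     (\<forall>m\<le>j. ((laplacian q K ^^ m) p) (q n) = 0 \<and>
            has_normal_deriv q ((laplacian q K ^^ m) p) 0 n \<and>
            has_tangential_deriv q ((laplacian q K ^^ m) p) (if m = j then 1 else 0) n)"

global_interpretation fun_space: vector_space "\<lambda>(c::real) (f::'a \<Rightarrow> real) x. c * f x"
  by unfold_locales (auto simp: fun_eq_iff algebra_simps)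

definition l2_inner :: "'a measure \<Rightarrow> ('a \<Rightarrow> real) \<Rightarrow> ('a \<Rightarrow> real) \<Rightarrow> real" where
  "l2_inner M f g = (\<integral>x. f x * g x \<partial>M)"

definition l2_norm :: "'a measure \<Rightarrow> ('a \<Rightarrow> real) \<Rightarrow> real" where
  "l2_norm M f = sqrt (l2_inner M f f)"

text \<open>\<open>F\<close> is a space of square-integrable functions that embeds into \<open>L\<^sup>2\<close>, i.e. distinct
  members of \<open>F\<close> are not identified modulo null sets. Then the dimension of \<open>F\<close> as a space of
  functions is its dimension in \<open>L\<^sup>2\<close>.\<close>

definition embeds_in_l2 :: "'a measure \<Rightarrow> ('a \<Rightarrow> real) set \<Rightarrow> bool" where
  "embeds_in_l2 M F \<longleftrightarrow>
     (\<forall>f\<in>F. f \<in> borel_measurable M \<and> integrable M (\<lambda>x. (f x)\<^sup>2)) \<and>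
     (\<forall>f\<in>F. (AE x in M. f x = 0) \<longrightarrow> f = (\<lambda>x. 0))"

definition tight_frame ::
    "'a measure \<Rightarrow> ('i::finite \<Rightarrow> 'a \<Rightarrow> real) \<Rightarrow> ('a \<Rightarrow> real) set \<Rightarrow> real \<Rightarrow> bool" where
  "tight_frame M e F A \<longleftrightarrow>
     range e \<subseteq> F \<and> 0 < A \<and> (\<forall>f\<in>F. (\<Sum>i\<in>UNIV. (l2_inner M f (e i))\<^sup>2) = A * (l2_norm M f)\<^sup>2)"

end

theory Submission
  imports Defs
begin

text \<open>If \<open>\<Delta>u = 0\<close> then \<open>u\<close> is exactly harmonic on every vertex graph, because the graph
  Laplacians of level \<open>m\<close> are averages of those of level \<open>m + 1\<close>. Hence \<open>u\<close> is determined by its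
  boundary values, and also by its value and its normal and tangential derivatives at one boundary
  point; so the monomials are unique. The affine symmetries of the triangle preserve the Laplacian,
  so rotations permute the monomials cyclically, and a reflection permutes them up to the sign of the
  tangential derivative. Thus each iterated Laplacian of the sum of the three monomials is odd under
  the reflection fixing \<open>q i\<close> and vanishes at \<open>q i\<close>, and downward induction on the order shows that
  the sum is zero. The measure is invariant under the symmetries, so the three monomials have
  equal norms and equal mutual inner products; as they add up to zero, they behave like
  three plane vectors at angles of 120 degrees.\<close>

section \<open>Arithmetic and sums over the three vertex indices\<close>

lemma arith_3: "(3 :: 3) = 0" "(4 :: 3) = 1" "(- 1 :: 3) = 2" "(- 2 :: 3) = 1"
  by simp_all

lemma UNIV_3_eq: "(UNIV :: 3 set) = {0, 1, 2}"
proof -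
  have "x \<in> {0, 1, 2}" for x :: 3
    using exhaust_3[of x] arith_3(1) by auto
  then show ?thesis by blast
qed

lemma sum_UNIV_3: "(\<Sum>i\<in>(UNIV :: 3 set). f i) = f 0 + f 1 + (f 2 :: 'a :: comm_monoid_add)"
  unfolding UNIV_3_eq by (simp add: add.assoc)

lemma cases_3 [case_names 0 1 2]:
  fixes i :: 3
  obtains "i = 0" | "i = 1" | "i = 2"
  using UNIV_3_eq by blast

lemma distinct_3: "distinct [i, i + 1, i - 1]" for i :: 3
  by (cases i rule: cases_3) simp_all

lemma sum_UNIV_3_cyclic:
  "(\<Sum>l\<in>(UNIV :: 3 set). f l) = f i + f (i + 1) + (f (i - 1) :: 'a :: comm_monoid_add)"
  by (cases i rule: cases_3) (simp_all add: sum_UNIV_3 arith_3 ac_simps)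

lemma range_3: "range f = {f 0, f 1, f (2::3)}"
  unfolding UNIV_3_eq by simp

lemma third_vertex:
  fixes i k :: 3 assumes "i \<noteq> k"
  obtains l where "l \<noteq> i" "l \<noteq> k" "UNIV = {i, k, l}"
proof -
  have "\<exists>l. l \<noteq> i \<and> l \<noteq> k \<and> UNIV = {i, k, l}"
    using assms unfolding UNIV_3_eq
    by (cases i rule: cases_3; cases k rule: cases_3)
       (auto intro: exI[of _ 0] exI[of _ 1] exI[of _ 2])
  then show ?thesis using that by blast
qed

lemma sum_UNIV_3_third:
  fixes i k l :: 3 assumes "i \<noteq> k" "l \<noteq> i" "l \<noteq> k" "UNIV = {i, k, l}"
  shows "(\<Sum>j\<in>UNIV. f j) = f i + f k + (f l :: 'a :: comm_monoid_add)"
  unfolding assms(4) using assms(1-3) by (simp add: add.assoc)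

subsection \<open>Barycentric coordinates\<close>

definition barycentre :: "(3 \<Rightarrow> real^2) \<Rightarrow> real^2" where
  "barycentre q = (1/3) *\<^sub>R (q 0 + q 1 + q 2)"

text \<open>For side length \<open>s\<close> the vectors from the centre to the vertices have squared norm
  \<open>s\<^sup>2/3\<close> and mutual inner products \<open>-s\<^sup>2/6\<close>, which fixes the two constants.\<close>

definition bary :: "(3 \<Rightarrow> real^2) \<Rightarrow> 3 \<Rightarrow> real^2 \<Rightarrow> real" where
  "bary q i x = 1/3 + 2 / (dist (q 0) (q 1))\<^sup>2 * ((x - barycentre q) \<bullet> (q i - barycentre q))"

locale gasket =
  fixes q :: "3 \<Rightarrow> real^2" and K :: "(real^2) set"
  assumes equilateral: "equilateral q" and gasket: "is_gasket q K"
begin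

abbreviation F where "F \<equiv> contr q"
abbreviation V where "V \<equiv> vertices q"
abbreviation Fw where "Fw \<equiv> contr_word q"
abbreviation \<beta> where "\<beta> \<equiv> bary q"

lemma compact_K: "compact K" and K_nonempty: "K \<noteq> {}" and K_eq: "K = (\<Union>i. F i ` K)"
  using gasket by (auto simp: is_gasket_def)

text \<open>The vectors from the barycentre to the three vertices add up to 0, so only the constants
  1/3 survive.\<close>

lemma bary_sum: "(\<Sum>i\<in>UNIV. \<beta> i x) = 1"
proof -
  define k where "k = 2 / (dist (q 0) (q 1))\<^sup>2"
  have "(\<Sum>i\<in>UNIV. \<beta> i x) = 1 + k * ((x - barycentre q) \<bullet> (q 0 + q 1 + q 2 - 3 *\<^sub>R barycentre q))"
    unfolding sum_UNIV_3 bary_def k_def[symmetric]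
    by (simp add: inner_simps algebra_simps)
  then show ?thesis by (simp add: barycentre_def)
qed

text \<open>With \<open>q 0\<close> as origin everything reduces to the edge vectors
  \<open>x\<close> and \<open>y\<close>; the three equal side lengths give their inner product
  s^2/2.\<close>

lemma bary_q: "\<beta> i (q k) = (if i = k then 1 else 0)"
proof -
  obtain s where s: "s > 0" "\<And>i j. i \<noteq> j \<Longrightarrow> dist (q i) (q j) = s"
    using equilateral by (auto simp: equilateral_def)
  define x where "x = q 1 - q 0"
  define y where "y = q 2 - q 0"
  have "norm x = s" "norm y = s" "norm (x - y) = s"
    using s(2)[of 1 0] s(2)[of 2 0] s(2)[of 1 2] by (simp_all add: x_def y_def dist_norm)
  then have xx: "x \<bullet> x = s\<^sup>2" and yy: "y \<bullet> y = s\<^sup>2" and "(x - y) \<bullet> (x - y) = s\<^sup>2"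
    by (simp_all add: dot_square_norm)
  then have xy: "x \<bullet> y = s\<^sup>2 / 2" by (simp add: inner_simps inner_commute)
  have q: "q 1 = q 0 + x" "q 2 = q 0 + y" by (simp_all add: x_def y_def)
  have c: "barycentre q = q 0 + (1/3) *\<^sub>R (x + y)"
    by (simp add: barycentre_def q vec_eq_iff)
  have s01: "dist (q 0) (q 1) = s" using s(2)[of 0 1] by simp
  show ?thesis unfolding bary_def s01 c
    using s(1)
    by (cases i rule: cases_3; cases k rule: cases_3)
       (simp_all add: q inner_simps xx yy xy inner_commute[of y x] field_simps)
qed

lemma bary_affine: "\<beta> i ((1 - t) *\<^sub>R x + t *\<^sub>R y) = (1 - t) * \<beta> i x + t * \<beta> i y"
  unfolding bary_def by (simp add: inner_simps algebra_simps add_divide_distrib diff_divide_distrib)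

lemma bary_contr: "\<beta> i (F k x) = (\<beta> i x + (if i = k then 1 else 0)) / 2"
proof -
  have "F k x = (1 - 1/2) *\<^sub>R x + (1/2) *\<^sub>R q k"
    by (simp add: contr_def vec_eq_iff field_simps)
  then show ?thesis using bary_affine[of i "1/2" x "q k"] by (simp add: bary_q)
qed

lemma continuous_bary: "continuous_on S (\<beta> i)"
  unfolding bary_def by (intro continuous_intros)

text \<open>As a function of the point, \<open>bary q i\<close> is a constant plus a linear
  functional; weights with sum 1 preserve the constant.\<close>

lemma bary_combination:
  assumes "(\<Sum>j\<in>UNIV. c j) = 1"
  shows "\<beta> i (\<Sum>j\<in>(UNIV :: 3 set). c j *\<^sub>R p j) = (\<Sum>j\<in>UNIV. c j * \<beta> i (p j))"
proof -
  define k where "k = 2 / (dist (q 0) (q 1))\<^sup>2"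
  define b where "b = q i - barycentre q"
  define a where "a = 1/3 - k * (barycentre q \<bullet> b)"
  have l: "\<beta> i y = a + k * (y \<bullet> b)" for y
    by (simp add: bary_def k_def[symmetric] a_def b_def inner_simps algebra_simps)
  have "\<beta> i (\<Sum>j\<in>UNIV. c j *\<^sub>R p j) = a * (\<Sum>j\<in>UNIV. c j) + (\<Sum>j\<in>UNIV. c j * (k * (p j \<bullet> b)))"
    unfolding l assms by (simp add: inner_sum_left sum_distrib_left algebra_simps)
  also have "\<dots> = (\<Sum>j\<in>UNIV. c j * \<beta> i (p j))"
    by (simp add: l sum_distrib_left sum.distrib algebra_simps)
  finally show ?thesis .
qed

text \<open>The combination \<open>z\<close> has the same coordinates as \<open>x\<close>, so
  \<open>z - x\<close> is orthogonal to the edge vectors \<open>e1\<close> and \<open>e2\<close>,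
  which span the plane.\<close>

lemma bary_reconstruct: "(\<Sum>i\<in>UNIV. \<beta> i x *\<^sub>R q i) = x"
proof -
  obtain s where s: "s > 0" "\<And>i j. i \<noteq> j \<Longrightarrow> dist (q i) (q j) = s"
    using equilateral by (auto simp: equilateral_def)
  define k where "k = 2 / (dist (q 0) (q 1))\<^sup>2"
  have k: "k \<noteq> 0" using s(2)[of 0 1] s(1) by (simp add: k_def)
  have diff: "\<beta> i x - \<beta> i z = k * ((x - z) \<bullet> (q i - barycentre q))" for i x z
    by (simp add: bary_def k_def[symmetric] inner_simps algebra_simps)
  define z where "z = (\<Sum>i\<in>UNIV. \<beta> i x *\<^sub>R q i)"
  have coord: "\<beta> i z = \<beta> i x" for i
    unfolding z_def bary_combination[of "\<lambda>i. \<beta> i x" i "\<lambda>i. q i", OF bary_sum] bary_q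
    by (simp add: if_distrib[of "(*) _"] cong: if_cong)
  define e1 where "e1 = q 1 - q 0"
  define e2 where "e2 = q 2 - q 0"
  have "(z - x) \<bullet> (q i - barycentre q) = 0" for i
    using diff[of i z x] k coord by simp
  then have "(z - x) \<bullet> q i = (z - x) \<bullet> barycentre q" for i
    by (simp add: inner_diff_right)
  then have orth: "(z - x) \<bullet> e1 = 0" "(z - x) \<bullet> e2 = 0"
    unfolding e1_def e2_def by (simp_all add: inner_diff_right)
  have "norm e1 = s" "norm e2 = s" "norm (e1 - e2) = s"
    using s(2)[of 1 0] s(2)[of 2 0] s(2)[of 1 2] by (simp_all add: e1_def e2_def dist_norm)
  then have xx: "e1 \<bullet> e1 = s\<^sup>2" and yy: "e2 \<bullet> e2 = s\<^sup>2" and "(e1 - e2) \<bullet> (e1 - e2) = s\<^sup>2"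
    by (simp_all add: dot_square_norm)
  then have xy: "e1 \<bullet> e2 = s\<^sup>2 / 2" by (simp add: inner_simps inner_commute)
  have e1: "e1 \<noteq> 0" using xx s(1) by auto
  have "e2 \<notin> span {e1}"
  proof
    assume "e2 \<in> span {e1}"
    then obtain t where t: "e2 = t *\<^sub>R e1" by (auto simp: span_singleton)
    \<comment> \<open>The inner product forces \<open>t = 1/2\<close>, the equal lengths force
      \<open>t * t = 1\<close>.\<close>
    have "t * s\<^sup>2 = s\<^sup>2/2" "t * (t * s\<^sup>2) = s\<^sup>2" using xy yy xx by (simp_all add: t)
    with s(1) have "t * 2 = 1" "t * t = 1" by auto
    then have "t = 1/2" by simp
    with \<open>t * t = 1\<close> have "(1/2 :: real) * (1/2) = 1" by simp
    then show False by simp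
  qed
  then have ind: "independent {e2, e1}" and ne: "e2 \<noteq> e1"
    using e1 by (auto simp: independent_insert span_base)
  then have "span {e2, e1} = (UNIV :: (real^2) set)"
    using dim_eq_full[of "{e2, e1}"] dim_eq_card_independent[OF ind] by simp
  then have "z - x \<in> span {e2, e1}" by simp
  moreover have "orthogonal (z - x) y" if "y \<in> {e2, e1}" for y
    using that orth by (auto simp: orthogonal_def)
  ultimately have "orthogonal (z - x) (z - x)"
    by (rule orthogonal_to_span)
  then show ?thesis by (simp add: z_def orthogonal_self)
qed

lemma bary_eqI:
  assumes "\<And>i. \<beta> i x = \<beta> i y" shows "x = y"
proof -
  have "(\<Sum>i\<in>UNIV. \<beta> i x *\<^sub>R q i) = (\<Sum>i\<in>UNIV. \<beta> i y *\<^sub>R q i)"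
    using assms by simp
  then show ?thesis by (simp only: bary_reconstruct)
qed

subsection \<open>Cells and vertices\<close>

lemma F_fix [simp]: "F i (q i) = q i" by (simp add: contr_def)

lemma F_swap: "F i (q k) = F k (q i)" by (simp add: contr_def vec_eq_iff field_simps)

lemma F_inj [simp]: "F i x = F i y \<longleftrightarrow> x = y" by (simp add: contr_def)

lemma q_inj [simp]: "q i = q k \<longleftrightarrow> i = k"
  by (metis bary_q zero_neq_one)

text \<open>The minimum over the compact set \<open>K\<close> is attained at some
  \<open>F k z\<close>, whose coordinate is at least half that of \<open>z\<close>. The minimum is
  therefore at least half of itself.\<close>

lemma bary_nonneg: "x \<in> K \<Longrightarrow> 0 \<le> \<beta> i x"
proof -
  assume x: "x \<in> K"
  obtain y where y: "y \<in> K" "\<And>z. z \<in> K \<Longrightarrow> \<beta> i y \<le> \<beta> i z"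
    using continuous_attains_inf[OF compact_K K_nonempty continuous_bary[of K i]] by blast
  from y(1) K_eq obtain k z where z: "z \<in> K" "y = F k z" by blast
  have "\<beta> i y = (\<beta> i z + (if i = k then 1 else 0)) / 2" using z bary_contr by simp
  moreover have "\<beta> i y \<le> \<beta> i z" using y z by simp
  ultimately have "0 \<le> \<beta> i y" by (auto split: if_splits)
  then show ?thesis using y(2)[OF x] by simp
qed

lemma bary_cell: "x \<in> K \<Longrightarrow> 1/2 \<le> \<beta> i (F i x)"
  using bary_nonneg[of x i] by (simp add: bary_contr)

text \<open>In the cell of \<open>k\<close> the coordinate \<open>\<beta> k\<close> is at least 1/2,
  and \<open>F i\<close> halves it when \<open>i \<noteq> k\<close>; so it is at least 1 at
  \<open>x\<close>. Nonnegative coordinates with sum 1 leave only the vertex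
  \<open>q k\<close>.\<close>

lemma cells_meet:
  assumes "i \<noteq> k" "x \<in> K" "y \<in> K" "F i x = F k y"
  shows "x = q k"
proof -
  obtain l where l: "l \<noteq> i" "l \<noteq> k" "UNIV = {i, k, l}" using third_vertex[OF assms(1)] .
  have 1: "\<beta> i x + \<beta> k x + \<beta> l x = 1"
    using bary_sum[of x] sum_UNIV_3_third[OF assms(1) l, of "\<lambda>i. \<beta> i x"] by simp
  have "1/2 \<le> \<beta> k (F i x)" using bary_cell[OF assms(3), of k] assms(4) by simp
  then have "1 \<le> \<beta> k x" using assms(1) by (simp add: bary_contr)
  then have b: "\<beta> k x = 1" "\<beta> i x = 0" "\<beta> l x = 0"
    using 1 bary_nonneg[OF assms(2), of i] bary_nonneg[OF assms(2), of l] by linarith+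
  show ?thesis
  proof (rule bary_eqI)
    fix j show "\<beta> j x = \<beta> j (q k)"
      using l(3) UNIV_I[of j] b by (auto simp: bary_q)
  qed
qed

lemma corner_cell:
  assumes "y \<in> K" "F k y = q i" shows "k = i \<and> y = q i"
proof -
  have "k = i" using bary_cell[OF assms(1), of k] assms(2) by (auto simp: bary_q split: if_splits)
  then show ?thesis using assms(2) F_inj[of i y "q i"] by simp
qed

lemma F_in_K: "x \<in> K \<Longrightarrow> F i x \<in> K"
  using K_eq by blast

lemma F_dist: "dist (F i x) (F i y) = dist x y / 2"
proof -
  have "F i x - F i y = (1/2) *\<^sub>R (x - y)"
    by (simp add: contr_def scaleR_diff_right)
  then have "norm (F i x - F i y) = 1/2 * norm (x - y)" by (simp only: norm_scaleR)
  then show ?thesis unfolding dist_norm by simp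
qed

text \<open>Iterates of \<open>F i\<close> move any point of \<open>K\<close> towards the fixed
  point of \<open>F i\<close>, and \<open>K\<close> is closed.\<close>

lemma q_in_K: "q i \<in> K"
proof -
  obtain x where x: "x \<in> K" using K_nonempty by blast
  have in_K: "(F i ^^ m) x \<in> K" for m by (induction m) (auto simp: x F_in_K)
  have d: "dist ((F i ^^ m) x) (q i) = (1/2) ^ m * dist x (q i)" for m
  proof (induction m)
    case (Suc m)
    show ?case using F_dist[of i "(F i ^^ m) x" "q i"] Suc by simp
  qed simp
  have "(\<lambda>m. (1/2) ^ m * dist x (q i)) \<longlonglongrightarrow> 0 * dist x (q i)"
    by (intro tendsto_intros LIMSEQ_power_zero) simp
  then have "(\<lambda>m. (F i ^^ m) x) \<longlonglongrightarrow> q i"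
    by (subst tendsto_dist_iff) (simp add: d)
  then show ?thesis
    by (rule closed_sequentially[OF compact_imp_closed[OF compact_K] in_K])
qed

lemma V_in_K: "x \<in> V m \<Longrightarrow> x \<in> K"
  by (induction m arbitrary: x) (auto simp: q_in_K F_in_K)

lemma q_in_V: "q i \<in> V m"
proof (induction m)
  case (Suc m)
  then have "F i (q i) \<in> V (Suc m)" unfolding vertices.simps by blast
  then show ?case by simp
qed simp

lemma V_Suc: "V m \<subseteq> V (Suc m)"
proof (induction m)
  case 0 then show ?case using q_in_V[of _ "Suc 0"] by auto
next
  case (Suc m)
  then show ?case unfolding vertices.simps(2)[of q "Suc m"] by (subst vertices.simps(2)) blast
qed

lemma V_mono: "m \<le> n \<Longrightarrow> V m \<subseteq> V n"
  using lift_Suc_mono_le[of V, OF V_Suc] .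

lemma finite_V: "finite (V m)"
  by (induction m) auto

lemma F_in_V0:
  assumes "x \<in> K" "F i x \<in> V 0" shows "x = q i"
proof -
  obtain k where "F i x = q k" using assms(2) by auto
  then show ?thesis using corner_cell[OF assms(1)] by blast
qed

lemma Fw_Nil [simp]: "Fw [] = id" and Fw_Cons [simp]: "Fw (i # w) x = F i (Fw w x)"
  by (simp_all add: contr_word_def)

lemma Fw_in_K: "x \<in> K \<Longrightarrow> Fw w x \<in> K"
  by (induction w) (auto simp: F_in_K)

lemma Fw_q_in_V: "Fw w (q i) \<in> V (length w)"
  by (induction w) auto

text \<open>By induction on the word: if the vertex comes from another first-level cell, the two
  cells share it only as a corner, which is again a vertex of the lower level.\<close>

lemma cell_vertices:
  assumes "x \<in> K" "Fw w x \<in> V (length w)"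
  shows "\<exists>k. x = q k"
  using assms
proof (induction w)
  case Nil then show ?case by auto
next
  case (Cons i w)
  then obtain k v where v: "v \<in> V (length w)" "F i (Fw w x) = F k v" by auto
  have "Fw w x \<in> V (length w)"
  proof (cases "i = k")
    case True then show ?thesis using v by simp
  next
    case False
    then have "Fw w x = q k"
      using cells_meet[OF False Fw_in_K[OF Cons.prems(1)] V_in_K[OF v(1)] v(2)] by simp
    then show ?thesis using q_in_V by simp
  qed
  then show ?case using Cons by blast
qed

lemma Fw_inj: "inj (Fw w)"
  by (induction w) (auto simp: inj_def)


subsection \<open>Graph Laplacians\<close>

text \<open>The graph Laplacian stripped of its factor \<open>3/2 * 5 ^ m\<close>, so that the
  recursions in the level are free of constants.\<close>

definition nbr_diff :: "nat \<Rightarrow> (real^2 \<Rightarrow> real) \<Rightarrow> real^2 \<Rightarrow> real" where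
  "nbr_diff m u x = (\<Sum>y\<in>neighbours q K m x. u y - u x)"

lemma neighbours_V: "neighbours q K m x \<subseteq> V m"
  by (auto simp: neighbours_def)

lemma finite_neighbours: "finite (neighbours q K m x)"
  using neighbours_V finite_V finite_subset by blast

lemma neighbours_in_K: "y \<in> neighbours q K m x \<Longrightarrow> y \<in> K"
  using neighbours_V V_in_K by blast

text \<open>Replaces arbitrary points of a common cell by its corners, so that adjacency becomes a
  matter of words and vertex indices.\<close>

lemma neighbours_iff:
  "y \<in> neighbours q K m x \<longleftrightarrow>
     (\<exists>w a b. length w = m \<and> a \<noteq> b \<and> x = Fw w (q a) \<and> y = Fw w (q b))"
proof
  assume "y \<in> neighbours q K m x"
  then obtain w x' y' where *: "x \<in> V m" "y \<in> V m" "x \<noteq> y" "length w = m"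
      "x' \<in> K" "x = Fw w x'" "y' \<in> K" "y = Fw w y'"
    by (auto simp: neighbours_def)
  then obtain a b where ab: "x' = q a" "y' = q b" using cell_vertices by metis
  with * have "a \<noteq> b" by auto
  with * ab show "\<exists>w a b. length w = m \<and> a \<noteq> b \<and> x = Fw w (q a) \<and> y = Fw w (q b)"
    by blast
next
  assume "\<exists>w a b. length w = m \<and> a \<noteq> b \<and> x = Fw w (q a) \<and> y = Fw w (q b)"
  then obtain w a b where *: "length w = m" "a \<noteq> b" "x = Fw w (q a)" "y = Fw w (q b)"
    by blast
  then have "x \<in> V m" "y \<in> V m" using Fw_q_in_V by blast+
  moreover have "x \<noteq> y" using * inj_eq[OF Fw_inj[of w]] by simp
  moreover have "x \<in> Fw w ` K" "y \<in> Fw w ` K" using * q_in_K by auto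
  ultimately show "y \<in> neighbours q K m x"
    using *(1) unfolding neighbours_def by blast
qed

text \<open>Splitting off the first letter of the word exhibits the graph of level
  \<open>Suc m\<close> as three contracted copies of the graph of level \<open>m\<close>.\<close>

lemma neighbours_Suc:
  "y \<in> neighbours q K (Suc m) x \<longleftrightarrow> (\<exists>i v z. x = F i v \<and> y = F i z \<and> z \<in> neighbours q K m v)"
proof
  assume "y \<in> neighbours q K (Suc m) x"
  then obtain w a b where *: "length w = Suc m" "a \<noteq> b" "x = Fw w (q a)" "y = Fw w (q b)"
    unfolding neighbours_iff by blast
  then obtain i w' where w: "w = i # w'" "length w' = m" by (auto simp: length_Suc_conv)
  then have "Fw w' (q b) \<in> neighbours q K m (Fw w' (q a))"
    using *(2) unfolding neighbours_iff by blast
  then show "\<exists>i v z. x = F i v \<and> y = F i z \<and> z \<in> neighbours q K m v"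
    using * w by auto
next
  assume "\<exists>i v z. x = F i v \<and> y = F i z \<and> z \<in> neighbours q K m v"
  then obtain i w a b where "length w = m" "a \<noteq> b" "x = F i (Fw w (q a))" "y = F i (Fw w (q b))"
    unfolding neighbours_iff by blast
  then have "length (i # w) = Suc m" "a \<noteq> b" "x = Fw (i # w) (q a)" "y = Fw (i # w) (q b)"
    by simp_all
  then show "y \<in> neighbours q K (Suc m) x" unfolding neighbours_iff by blast
qed

lemma neighbours_source: "y \<in> neighbours q K m x \<Longrightarrow> x \<in> V m"
  by (auto simp: neighbours_def)

lemma F_interior:
  assumes "v \<in> V m - V 0" shows "F i v \<in> V (Suc m) - V 0"
proof -
  have "F i v \<notin> V 0"
  proof
    assume "F i v \<in> V 0"
    then have "v = q i" using F_in_V0 assms V_in_K by blast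
    then show False using assms by simp
  qed
  then show ?thesis using assms unfolding vertices.simps(2) by blast
qed

lemma F_q_in_V1: "F i (q k) \<in> V (Suc 0)"
  by auto

lemma F_midpoint_notin_V0: "i \<noteq> k \<Longrightarrow> F i (q k) \<notin> V 0"
proof
  assume "i \<noteq> k" "F i (q k) \<in> V 0"
  then have "q k = q i" using F_in_V0 q_in_K by blast
  then show False using \<open>i \<noteq> k\<close> by simp
qed

text \<open>The index \<open>k = i\<close> contributes 0, so the sum can run over all three
  vertices.\<close>

lemma nbr_diff_0: "nbr_diff 0 u (q i) = (\<Sum>k\<in>UNIV. u (q k) - u (q i))"
proof -
  have "y \<in> neighbours q K 0 (q i) \<longleftrightarrow> y \<in> q ` (UNIV - {i})" for y
  proof -
    have "y \<in> neighbours q K 0 (q i) \<longleftrightarrow> (\<exists>b. i \<noteq> b \<and> y = q b)"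
      by (simp add: neighbours_iff)
    then show ?thesis by auto
  qed
  then have "neighbours q K 0 (q i) = q ` (UNIV - {i})" by blast
  then have "nbr_diff 0 u (q i) = (\<Sum>k\<in>UNIV - {i}. u (q k) - u (q i))"
    unfolding nbr_diff_def by (simp add: sum.reindex inj_on_def)
  then show ?thesis by (simp add: sum.remove[of UNIV i])
qed

lemma nbr_diff_image: "(\<Sum>y\<in>F i ` neighbours q K m v. u y - u (F i v)) = nbr_diff m (u \<circ> F i) v"
  unfolding nbr_diff_def by (simp add: sum.reindex inj_on_def)

text \<open>Different first-level cells meet only at images of corners, so a contracted interior
  vertex has all its neighbours in its own cell.\<close>

lemma nbr_diff_Suc_interior:
  assumes "v \<in> V m - V 0"
  shows "nbr_diff (Suc m) u (F i v) = nbr_diff m (u \<circ> F i) v"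
proof -
  have "k = i \<and> v' = v" if "F i v = F k v'" "v' \<in> V m" for k v'
    using cells_meet[of i k v v'] that assms V_in_K by (cases "i = k") auto
  then have "neighbours q K (Suc m) (F i v) = F i ` neighbours q K m v"
    unfolding set_eq_iff neighbours_Suc image_iff Bex_def by (metis neighbours_source)
  then show ?thesis using nbr_diff_image by (simp add: nbr_diff_def)
qed

lemma nbr_diff_Suc_corner: "nbr_diff (Suc m) u (q i) = nbr_diff m (u \<circ> F i) (q i)"
proof -
  have "k = i \<and> v' = q i" if "q i = F k v'" "v' \<in> V m" for k v'
    using corner_cell[of v' k i] that V_in_K by auto
  then have "neighbours q K (Suc m) (q i) = F i ` neighbours q K m (q i)"
    unfolding set_eq_iff neighbours_Suc image_iff Bex_def by (metis neighbours_source F_fix)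
  then show ?thesis using nbr_diff_image[where i = i and v = "q i" and u = u and m = m] by (simp add: nbr_diff_def)
qed

text \<open>The midpoint is the only common point of the cells \<open>i\<close> and \<open>k\<close>
  and lies in no third one, so its neighbours split into two disjoint corner neighbourhoods.\<close>

lemma nbr_diff_Suc_midpoint:
  assumes "i \<noteq> k"
  shows "nbr_diff (Suc m) u (F i (q k)) = nbr_diff m (u \<circ> F i) (q k) + nbr_diff m (u \<circ> F k) (q i)"
proof -
  have *: "l = i \<and> v' = q k \<or> l = k \<and> v' = q i" if "F i (q k) = F l v'" "v' \<in> V m" for l v'
  proof -
    have "v' \<in> K" using that V_in_K by simp
    then show ?thesis
      using cells_meet[of i l "q k" v'] cells_meet[of l i v' "q k"] that q_in_K F_swap[of i k]
      by (cases "l = i") auto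
  qed
  have "neighbours q K (Suc m) (F i (q k)) = F i ` neighbours q K m (q k) \<union> F k ` neighbours q K m (q i)"
    (is "?N = ?A \<union> ?B")
  proof (rule set_eqI)
    fix y
    show "y \<in> ?N \<longleftrightarrow> y \<in> ?A \<union> ?B"
      unfolding neighbours_Suc using * neighbours_source F_swap[of i k] by blast
  qed
  moreover have "?A \<inter> ?B = {}"
  proof -
    have False if "y \<in> neighbours q K m (q k)" "z \<in> neighbours q K m (q i)" "F i y = F k z" for y z
    proof -
      have "y = q k" using cells_meet[OF assms _ _ that(3)] that(1,2) neighbours_in_K by blast
      then show False using that(1) by (simp add: neighbours_def)
    qed
    then show ?thesis by blast
  qed
  ultimately have "nbr_diff (Suc m) u (F i (q k)) =
      (\<Sum>y\<in>?A. u y - u (F i (q k))) + (\<Sum>y\<in>?B. u y - u (F k (q i)))"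
    unfolding nbr_diff_def using finite_neighbours F_swap[of i k] by (simp add: sum.union_disjoint)
  then show ?thesis using nbr_diff_image by simp
qed

text \<open>With corners \<open>a, b, c\<close> and midpoints \<open>x, y, z\<close> opposite to them, the
  difference \<open>b + c - 2a\<close> at the corner \<open>a\<close> is recovered from \<open>y + z - 2a\<close> up to a combination of the three
  midpoint Laplacians whose coefficients 2/5, 2/5, 1/5 add up to 1.\<close>

lemma nbr_diff_corner_renormalized:
  assumes "\<And>v. v \<in> V (Suc m) - V 0 \<Longrightarrow> \<bar>nbr_diff (Suc m) u v\<bar> \<le> e"
  shows "\<bar>3/5 * nbr_diff m u (q i) - nbr_diff (Suc m) u (q i)\<bar> \<le> e"
  using assms
proof (induction m arbitrary: u)
  case 0
  define k l where "k = i + 1" and "l = i - 1"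
  have ne: "i \<noteq> k" "i \<noteq> l" "k \<noteq> l" "k \<noteq> i" "l \<noteq> i" "l \<noteq> k"
    using distinct_3[of i] by (auto simp: k_def l_def)
  have S: "(\<Sum>j\<in>UNIV. f j) = f i + f k + f l" for f :: "3 \<Rightarrow> real"
    unfolding k_def l_def by (rule sum_UNIV_3_cyclic)
  have mid: "\<bar>nbr_diff (Suc 0) u (F a (q b))\<bar> \<le> e" if "a \<noteq> b" for a b
    by (rule 0) (use F_midpoint_notin_V0[OF that] in auto)
  have exp: "nbr_diff (Suc 0) u (F a (q b)) =
      (\<Sum>j\<in>UNIV. u (F a (q j)) - u (F a (q b))) + (\<Sum>j\<in>UNIV. u (F b (q j)) - u (F b (q a)))" if "a \<noteq> b" for a b
    using nbr_diff_Suc_midpoint[OF that] by (simp add: nbr_diff_0)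
  note m = mid[OF ne(1)] mid[OF ne(2)] mid[OF ne(3)]
  note m' = m[unfolded exp[OF ne(1)] exp[OF ne(2)] exp[OF ne(3)] S]
  have "nbr_diff (Suc 0) u (q i) = (\<Sum>j\<in>UNIV. u (F i (q j)) - u (q i))"
    by (simp add: nbr_diff_Suc_corner nbr_diff_0)
  moreover have renorm: "\<bar>3/5 * (b + c - 2 * a) - (y + z - 2 * a)\<bar> \<le> e"
    if "\<bar>a + b + x + z - 4 * y\<bar> \<le> e" "\<bar>a + c + x + y - 4 * z\<bar> \<le> e" "\<bar>b + c + y + z - 4 * x\<bar> \<le> e"
    for a b c x y z :: real
  proof -
    have "3/5 * (b + c - 2 * a) - (y + z - 2 * a) =
      2/5 * (a + b + x + z - 4 * y) + 2/5 * (a + c + x + y - 4 * z) + 1/5 * (b + c + y + z - 4 * x)"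
      by (simp add: field_simps)
    moreover have "\<bar>2/5 * A + 2/5 * B + 1/5 * C\<bar> \<le> e" if "\<bar>A\<bar> \<le> e" "\<bar>B\<bar> \<le> e" "\<bar>C\<bar> \<le> e" for A B C :: real
      using that by linarith
    ultimately show ?thesis using that by (simp only:)
  qed
  ultimately show ?case
    using m' unfolding nbr_diff_0 S
    using renorm[of "u (q i)" "u (q k)" "u (F k (q l))" "u (F i (q l))" "u (F i (q k))" "u (q l)"]
    by (simp add: F_swap[of k i] F_swap[of l i] F_swap[of l k] algebra_simps)
next
  case (Suc m)
  \<comment> \<open>The corner \<open>q i\<close> sees only its own first-level cell, so the bound
    is handed to the rescaled function \<open>u \<circ> F i\<close>.\<close>
  have "\<bar>nbr_diff (Suc m) (u \<circ> F i) v\<bar> \<le> e" if "v \<in> V (Suc m) - V 0" for v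
    using Suc.prems[OF F_interior[OF that]] nbr_diff_Suc_interior[OF that] by simp
  from Suc.IH[OF this] show ?case by (simp only: nbr_diff_Suc_corner)
qed

text \<open>The constant is exactly the factor of the rescaling \<open>5 ^ m\<close>, so the supremum of the
  rescaled graph Laplacians can only increase with the level; if it tends to 0, it is 0.\<close>

lemma nbr_diff_bound_Suc:
  assumes "\<And>v. v \<in> V (Suc m) - V 0 \<Longrightarrow> \<bar>nbr_diff (Suc m) u v\<bar> \<le> e" "x \<in> V m - V 0"
  shows "\<bar>nbr_diff m u x\<bar> \<le> 5 * e"
  using assms
proof (induction m arbitrary: u x)
  case 0 then show ?case by simp
next
  case (Suc m)
  have bd: "\<bar>nbr_diff (Suc m) (u \<circ> F i) v\<bar> \<le> e" if "v \<in> V (Suc m) - V 0" for i v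
    using Suc.prems(1)[OF F_interior[OF that]] nbr_diff_Suc_interior[OF that] by simp
  obtain i v where v: "x = F i v" "v \<in> V m" using Suc.prems(2) by auto
  show ?case
  proof (cases "v \<in> V 0")
    case False
    then show ?thesis using Suc.IH[OF bd, of v i] v nbr_diff_Suc_interior[of v m u i] by (simp add: o_def)
  next
    case True
    then obtain k where k: "v = q k" by auto
    then have ik: "i \<noteq> k" using Suc.prems(2) v by auto
    have 1: "\<bar>3/5 * nbr_diff m (u \<circ> F i) (q k) - nbr_diff (Suc m) (u \<circ> F i) (q k)\<bar> \<le> e"
      "\<bar>3/5 * nbr_diff m (u \<circ> F k) (q i) - nbr_diff (Suc m) (u \<circ> F k) (q i)\<bar> \<le> e"
      using nbr_diff_corner_renormalized[OF bd] by blast+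
    have "x \<in> V (Suc (Suc m)) - V 0" using Suc.prems(2) V_Suc[of "Suc m"] by blast
    from Suc.prems(1)[OF this]
    have "\<bar>nbr_diff (Suc m) (u \<circ> F i) (q k) + nbr_diff (Suc m) (u \<circ> F k) (q i)\<bar> \<le> e"
      using v k nbr_diff_Suc_midpoint[OF ik] by simp
    \<comment> \<open>Three errors of size \<open>e\<close> bound 3/5 of the value by
      \<open>3 * e\<close>, which is where the constant 5 comes from.\<close>
    then show ?thesis using 1 v k nbr_diff_Suc_midpoint[OF ik] by simp
  qed
qed

lemma nbr_diff_bound_add:
  assumes "\<And>v. v \<in> V (m + n) - V 0 \<Longrightarrow> \<bar>nbr_diff (m + n) u v\<bar> \<le> e" "x \<in> V m - V 0"
  shows "\<bar>nbr_diff m u x\<bar> \<le> 5 ^ n * e"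
  using assms
proof (induction n arbitrary: e)
  case 0 then show ?case by simp
next
  case (Suc n)
  have "\<bar>nbr_diff (m + n) u v\<bar> \<le> 5 * e" if "v \<in> V (m + n) - V 0" for v
    by (rule nbr_diff_bound_Suc[OF _ that]) (use Suc.prems(1) in simp)
  from Suc.IH[OF this Suc.prems(2)] show ?case by simp
qed

subsection \<open>Harmonic functions and uniqueness\<close>

definition harmonic :: "(real^2 \<Rightarrow> real) \<Rightarrow> bool" where
  "harmonic u \<longleftrightarrow> (\<forall>m. \<forall>x\<in>V m - V 0. nbr_diff m u x = 0)"

lemma graph_laplacian_nbr_diff: "graph_laplacian q K m u x = 3/2 * 5 ^ m * nbr_diff m u x"
  by (simp add: graph_laplacian_def nbr_diff_def)

text \<open>Far enough out, all rescaled Laplacians are below \<open>e\<close>. The descent from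
  there to level \<open>m\<close> costs no more than the rescaling gains, and \<open>e\<close> is
  arbitrary.\<close>

lemma has_laplacian_0_harmonic:
  assumes "has_laplacian q K u (\<lambda>x. 0)"
  shows "harmonic u"
  unfolding harmonic_def
proof (intro allI ballI)
  fix m x assume x: "x \<in> V m - V 0"
  have "\<bar>nbr_diff m u x\<bar> \<le> 0 + e" if e: "e > 0" for e :: real
  proof -
    obtain N where N: "\<And>n v. n \<ge> N \<Longrightarrow> v \<in> V n - V 0 \<Longrightarrow> \<bar>3/2 * 5 ^ n * nbr_diff n u v\<bar> < e"
      using assms e unfolding has_laplacian_def graph_laplacian_nbr_diff by fastforce
    have "\<bar>nbr_diff (m + N) u v\<bar> \<le> e / 5 ^ (m + N)" if "v \<in> V (m + N) - V 0" for v
    proof -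
      have "3/2 * 5 ^ (m + N) * \<bar>nbr_diff (m + N) u v\<bar> < e"
        using N[OF _ that] by (simp add: abs_mult)
      moreover have "5 ^ (m + N) * \<bar>nbr_diff (m + N) u v\<bar> \<le> 3/2 * 5 ^ (m + N) * \<bar>nbr_diff (m + N) u v\<bar>"
        by simp
      ultimately have "5 ^ (m + N) * \<bar>nbr_diff (m + N) u v\<bar> \<le> e" by linarith
      then show ?thesis by (simp add: field_simps)
    qed
    from nbr_diff_bound_add[OF this x] have "\<bar>nbr_diff m u x\<bar> \<le> e / 5 ^ m"
      by (simp add: power_add)
    also have "\<dots> \<le> e" using e by (simp add: field_simps)
    finally show ?thesis by simp
  qed
  then have "\<bar>nbr_diff m u x\<bar> \<le> 0" by (rule field_le_epsilon)
  then show "nbr_diff m u x = 0" by simp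
qed

lemma harmonic_F: "harmonic u \<Longrightarrow> harmonic (u \<circ> F i)"
  unfolding harmonic_def using nbr_diff_Suc_interior F_interior by metis

text \<open>The 1/5-2/5 rule: harmonicity at the three midpoints is a linear system of three
  equations for the three midpoint values.\<close>

lemma harmonic_midpoint:
  assumes "harmonic u" and "distinct [i, k, l]"
  shows "u (F i (q k)) = (2 * u (q i) + 2 * u (q k) + u (q l)) / 5"
proof -
  have ne: "i \<noteq> k" "i \<noteq> l" "k \<noteq> l" using assms(2) by auto
  have U: "UNIV = {i, k, l}"
    using third_vertex[OF ne(1)] ne by (metis insert_iff UNIV_I empty_iff)
  have S: "(\<Sum>j\<in>UNIV. f j) = f i + f k + f l" for f :: "3 \<Rightarrow> real"
    using sum_UNIV_3_third[OF ne(1) _ _ U] ne by metis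
  have exp: "(\<Sum>j\<in>UNIV. u (F a (q j)) - u (F a (q b))) + (\<Sum>j\<in>UNIV. u (F b (q j)) - u (F b (q a))) = 0"
    if "a \<noteq> b" for a b
  proof -
    have "nbr_diff (Suc 0) u (F a (q b)) = 0"
      using assms(1) F_midpoint_notin_V0[OF that] F_q_in_V1 unfolding harmonic_def by blast
    then show ?thesis using nbr_diff_Suc_midpoint[OF that, of 0 u] by (simp add: nbr_diff_0)
  qed
  show ?thesis
    using exp[OF ne(1)] exp[OF ne(2)] exp[OF ne(3)] unfolding S
    by (simp add: F_swap[of k i] F_swap[of l i] F_swap[of l k])
qed

text \<open>By the midpoint rule zeros at the corners of a cell pass to the corners of its
  subcells.\<close>

lemma harmonic_zero_V:
  assumes "harmonic u" "\<And>i. u (q i) = 0" "x \<in> V m"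
  shows "u x = 0"
  using assms
proof (induction m arbitrary: u x)
  case 0 then show ?case by auto
next
  case (Suc m)
  then obtain i v where v: "x = F i v" "v \<in> V m" by auto
  have "(u \<circ> F i) (q k) = 0" for k
  proof (cases "i = k")
    case True then show ?thesis using Suc.prems(2) by simp
  next
    case False
    then obtain l where "l \<noteq> i" "l \<noteq> k" using third_vertex by metis
    then show ?thesis using harmonic_midpoint[OF Suc.prems(1), of i k l] False Suc.prems(2) by auto
  qed
  from Suc.IH[OF harmonic_F[OF Suc.prems(1)] this v(2)] show ?case using v by simp
qed


section \<open>Small cells, density of interior vertices and uniqueness of the Laplacian\<close>

lemma Fw_dist: "dist (Fw w x) (Fw w y) = dist x y / 2 ^ length w"
  by (induction w) (simp_all add: F_dist)

lemma cells_cover: "x \<in> K \<Longrightarrow> \<exists>w. length w = m \<and> x \<in> Fw w ` K"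
proof (induction m arbitrary: x)
  case 0 then show ?case by (intro exI[of _ "[]"]) simp
next
  case (Suc m)
  then obtain i y where y: "y \<in> K" "x = F i y" using K_eq by blast
  from Suc.IH[OF y(1)] obtain w z where "length w = m" "z \<in> K" "y = Fw w z" by blast
  then show ?case using y by (intro exI[of _ "i # w"]) auto
qed

lemma Fw_interior: "v \<in> V m - V 0 \<Longrightarrow> Fw w v \<in> V (length w + m) - V 0"
proof (induction w)
  case (Cons i w)
  from F_interior[OF Cons.IH[OF Cons.prems], of i] show ?case by (simp del: vertices.simps)
qed simp

lemma cells_small:
  assumes "0 < e"
  shows "\<exists>M. \<forall>w\<in>{w. length w \<ge> M}. \<forall>x\<in>Fw w ` K. \<forall>y\<in>Fw w ` K. dist x y < e"
proof -
  obtain D where D: "\<And>x y. x \<in> K \<Longrightarrow> y \<in> K \<Longrightarrow> dist x y \<le> D"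
    using compact_imp_bounded[OF compact_K] by (auto simp: bounded_two_points)
  obtain M where M: "D / e < 2 ^ M" using real_arch_pow[of 2 "D / e"] by auto
  show ?thesis
  proof (intro exI[of _ M] ballI)
    fix w x y assume w: "w \<in> {w :: 3 list. M \<le> length w}" "x \<in> Fw w ` K" "y \<in> Fw w ` K"
    then obtain x' y' where xy: "x' \<in> K" "y' \<in> K" "x = Fw w x'" "y = Fw w y'" by blast
    have "(2::real) ^ M \<le> 2 ^ length w" using w by (intro power_increasing) auto
    then have "D / e < 2 ^ length w" using M by linarith
    then have "D < e * 2 ^ length w" using assms by (simp add: field_simps)
    then have "dist x' y' < e * 2 ^ length w" using D[OF xy(1,2)] by linarith
    then show "dist x y < e" by (simp add: xy Fw_dist field_simps)
  qed
qed

text \<open>The midpoint \<open>F 0 (q 1)\<close> is interior and stays so under every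
  \<open>Fw w\<close>; a small cell containing \<open>x\<close> carries it close to
  \<open>x\<close>.\<close>

lemma interior_dense:
  assumes "x \<in> K" "0 < e"
  obtains m y where "y \<in> V m - V 0" "dist x y < e"
proof -
  obtain M where M: "\<And>w x y. length w \<ge> M \<Longrightarrow> x \<in> Fw w ` K \<Longrightarrow> y \<in> Fw w ` K \<Longrightarrow> dist x y < e"
    using cells_small[OF assms(2)] by blast
  obtain w where w: "length w = M" "x \<in> Fw w ` K" using cells_cover[OF assms(1)] by blast
  have v: "F 0 (q 1) \<in> V (Suc 0) - V 0" using F_midpoint_notin_V0[of 0 1] F_q_in_V1 by auto
  have "dist x (Fw w (F 0 (q 1))) < e"
    using M[of w x "Fw w (F 0 (q 1))"] w F_in_K[OF q_in_K] by simp
  then show ?thesis using that Fw_interior[OF v] by blast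
qed

text \<open>Laplacians are prescribed only at interior vertices; density and continuity extend
  equalities from there to all of \<open>K\<close>, boundary points included.\<close>

lemma continuous_eqI:
  assumes f: "continuous_on K f" and g: "continuous_on K g"
    and eq: "\<And>m x. x \<in> V m - V 0 \<Longrightarrow> f x = (g x :: real)" and x: "x \<in> K"
  shows "f x = g x"
proof (rule ccontr)
  assume "f x \<noteq> g x"
  then have "0 < dist (f x - g x) 0" by simp
  moreover have "continuous_on K (\<lambda>x. f x - g x)" using f g by (intro continuous_intros)
  ultimately obtain d where d: "d > 0"
    "\<And>y. y \<in> K \<Longrightarrow> dist y x < d \<Longrightarrow> dist (f y - g y) (f x - g x) < dist (f x - g x) 0"
    using x unfolding continuous_on_iff by blast
  obtain m y where y: "y \<in> V m - V 0" "dist x y < d" using interior_dense[OF x d(1)] .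
  then have "dist (f y - g y) (f x - g x) < dist (f x - g x) 0"
    using d(2)[of y] V_in_K[of y m] by (simp add: dist_commute)
  then show False using eq[OF y(1)] by (simp add: dist_norm)
qed

text \<open>Gives meaning to the definite description in \<open>laplacian\<close>. At an interior
  vertex both functions are limits of the same sequence.\<close>

lemma has_laplacian_unique:
  assumes f: "has_laplacian q K u f" and g: "has_laplacian q K u g"
  shows "f = g"
proof
  fix x
  have "f x = g x" if "x \<in> K"
  proof (rule continuous_eqI[OF _ _ _ that])
    show "continuous_on K f" "continuous_on K g" using f g by (auto simp: has_laplacian_def)
    fix m x assume x: "x \<in> V m - V 0"
    have "\<bar>f x - g x\<bar> \<le> 0 + e" if e: "e > 0" for e
    proof -
      obtain N1 where N1: "\<And>m x. m \<ge> N1 \<Longrightarrow> x \<in> V m - V 0 \<Longrightarrow> \<bar>graph_laplacian q K m u x - f x\<bar> < e/2"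
        using f half_gt_zero[OF e] unfolding has_laplacian_def by blast
      obtain N2 where N2: "\<And>m x. m \<ge> N2 \<Longrightarrow> x \<in> V m - V 0 \<Longrightarrow> \<bar>graph_laplacian q K m u x - g x\<bar> < e/2"
        using g half_gt_zero[OF e] unfolding has_laplacian_def by blast
      \<comment> \<open>The level must also be at least \<open>m\<close>, so that \<open>x\<close>
        is one of its vertices.\<close>
      define M where "M = max m (max N1 N2)"
      have "x \<in> V M - V 0" using x V_mono[of m M] by (auto simp: M_def simp del: vertices.simps)
      then have "\<bar>graph_laplacian q K M u x - f x\<bar> < e/2" "\<bar>graph_laplacian q K M u x - g x\<bar> < e/2"
        using N1[of M x] N2[of M x] by (auto simp: M_def simp del: vertices.simps)
      then show ?thesis by linarith
    qed
    then have "\<bar>f x - g x\<bar> \<le> 0" by (rule field_le_epsilon)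
    then show "f x = g x" by simp
  qed
  moreover have "f x = g x" if "x \<notin> K"
    using f g that by (simp add: has_laplacian_def on_gasket_def)
  ultimately show "f x = g x" by blast
qed

lemma laplacian_eq: "has_laplacian q K u f \<Longrightarrow> laplacian q K u = f"
  unfolding laplacian_def by (rule the_equality) (auto intro: has_laplacian_unique)

lemma has_laplacian_laplacian: "in_dom_laplacian q K u \<Longrightarrow> has_laplacian q K u (laplacian q K u)"
  unfolding in_dom_laplacian_def by (elim exE) (simp add: laplacian_eq)

lemma dirichlet_unique:
  assumes u: "has_laplacian q K u (\<lambda>x. 0)" and "\<And>i. u (q i) = 0"
  shows "u = (\<lambda>x. 0)"
proof
  fix x
  have "u x = 0" if "x \<in> K"
  proof (rule continuous_eqI[of u "\<lambda>x. 0", OF _ _ _ that])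
    show "continuous_on K u" using u by (simp add: has_laplacian_def)
    show "u x = 0" if "x \<in> V m - V 0" for m x
      using harmonic_zero_V[OF has_laplacian_0_harmonic[OF u] assms(2)] that by blast
  qed simp
  moreover have "u x = 0" if "x \<notin> K"
    using u that by (simp add: has_laplacian_def on_gasket_def)
  ultimately show "u x = 0" by blast
qed

section \<open>Harmonic functions near a boundary point\<close>

lemma harmonic_funpow: "harmonic u \<Longrightarrow> harmonic (u \<circ> (F i ^^ m))"
proof (induction m)
  case (Suc m)
  have "u \<circ> (F i ^^ Suc m) = (u \<circ> (F i ^^ m)) \<circ> F i" by (simp only: funpow_Suc_right o_assoc)
  then show ?case using harmonic_F[OF Suc.IH[OF Suc.prems]] by (simp only:)
qed simp

lemma funpow_F_fix [simp]: "(F i ^^ m) (q i) = q i"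
  by (induction m) auto

lemma harmonic_midpoint_funpow:
  assumes "harmonic u" and "distinct [i, k, l]"
  shows "u ((F i ^^ Suc m) (q k)) =
    (2 * u (q i) + 2 * u ((F i ^^ m) (q k)) + u ((F i ^^ m) (q l))) / 5"
  using harmonic_midpoint[OF harmonic_funpow[OF assms(1), where i = i and m = m] assms(2)]
  by (simp only: funpow_Suc_right o_apply funpow_F_fix)

text \<open>Since \<open>u (q n) = 0\<close>, zooming in at \<open>q n\<close> acts linearly on the
  other two corner values: their difference is multiplied by 1/5, their sum by 3/5. The derivatives
  rescale by 5 and 5/3, so both sequences are constant and equal to their limit 0.\<close>

lemma harmonic_jet_zero:
  assumes h: "harmonic u" and "u (q n) = 0"
    and "has_normal_deriv q u 0 n" and "has_tangential_deriv q u 0 n"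
  shows "u (q i) = 0"
proof -
  define b c where "b = (\<lambda>m. u ((F n ^^ m) (q (n + 1))))" and "c = (\<lambda>m. u ((F n ^^ m) (q (n - 1))))"
  have d: "distinct [n, n + 1, n - 1]" "distinct [n, n - 1, n + 1]"
    using distinct_3[of n] by auto
  have b: "b (Suc m) = (2 * b m + c m) / 5" and c: "c (Suc m) = (2 * c m + b m) / 5" for m
    using harmonic_midpoint_funpow[OF h d(1), of m] harmonic_midpoint_funpow[OF h d(2), of m] assms(2)
    by (simp_all add: b_def c_def)
  have bc: "5 ^ m * (b m - c m) = b 0 - c 0" "(5/3) ^ m * (- b m - c m) = - b 0 - c 0" for m
    by (induction m) (simp_all add: b c field_simps)
  have "(\<lambda>m. 5 ^ m * (b m - c m)) \<longlonglongrightarrow> 0"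
    using assms(4) unfolding has_tangential_deriv_def b_def c_def .
  moreover have "(\<lambda>m. (5/3) ^ m * (2 * u (q n) - b m - c m)) \<longlonglongrightarrow> 0"
    using assms(3) unfolding has_normal_deriv_def b_def c_def .
  then have "(\<lambda>m. (5/3) ^ m * (- b m - c m)) \<longlonglongrightarrow> 0" by (simp only: assms(2) mult_zero_right diff_0)
  ultimately have "(\<lambda>m. b 0 - c 0) \<longlonglongrightarrow> 0" "(\<lambda>m. - b 0 - c 0) \<longlonglongrightarrow> 0"
    by (simp_all only: bc)
  then have "b 0 - c 0 = 0" "- b 0 - c 0 = 0" by (simp_all only: LIMSEQ_const_iff)
  then have "b 0 = 0" "c 0 = 0" by linarith+
  moreover have "i = n \<or> i = n + 1 \<or> i = n - 1"
    by (cases i rule: cases_3; cases n rule: cases_3) (simp_all add: arith_3)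
  ultimately show ?thesis using assms(2) by (auto simp: b_def c_def)
qed

section \<open>Linearity and chains of iterated Laplacians\<close>

lemma has_laplacian_lincomb:
  assumes u: "has_laplacian q K u f" and v: "has_laplacian q K v g"
  shows "has_laplacian q K (\<lambda>x. a * u x + b * v x) (\<lambda>x. a * f x + b * g x)"
proof -
  have gl: "graph_laplacian q K m (\<lambda>x. a * u x + b * v x) x =
      a * graph_laplacian q K m u x + b * graph_laplacian q K m v x" for m x
  proof -
    have "(\<Sum>y\<in>neighbours q K m x. (a * u y + b * v y) - (a * u x + b * v x)) =
        a * (\<Sum>y\<in>neighbours q K m x. u y - u x) + b * (\<Sum>y\<in>neighbours q K m x. v y - v x)"
      unfolding sum_distrib_left sum.distrib[symmetric] by (simp add: algebra_simps)
    then show ?thesis unfolding graph_laplacian_def by (simp add: algebra_simps)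
  qed
  have "\<exists>N. \<forall>m\<ge>N. \<forall>x\<in>V m - V 0.
      \<bar>graph_laplacian q K m (\<lambda>x. a * u x + b * v x) x - (a * f x + b * g x)\<bar> < e"
    if e: "e > 0" for e
  proof -
    \<comment> \<open>The summand 1 keeps the divisor positive and makes the final bound
      strict.\<close>
    define d where "d = e / (\<bar>a\<bar> + \<bar>b\<bar> + 1)"
    have d: "d > 0" using e by (simp add: d_def)
    obtain N1 where N1: "\<And>m x. m \<ge> N1 \<Longrightarrow> x \<in> V m - V 0 \<Longrightarrow> \<bar>graph_laplacian q K m u x - f x\<bar> < d"
      using u d unfolding has_laplacian_def by blast
    obtain N2 where N2: "\<And>m x. m \<ge> N2 \<Longrightarrow> x \<in> V m - V 0 \<Longrightarrow> \<bar>graph_laplacian q K m v x - g x\<bar> < d"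
      using v d unfolding has_laplacian_def by blast
    show ?thesis
    proof (intro exI[of _ "max N1 N2"] allI impI ballI)
      fix m x assume m: "max N1 N2 \<le> m" and x: "x \<in> V m - V 0"
      define A B where "A = graph_laplacian q K m u x - f x" and "B = graph_laplacian q K m v x - g x"
      have AB: "\<bar>A\<bar> < d" "\<bar>B\<bar> < d" using N1[OF _ x] N2[OF _ x] m by (auto simp: A_def B_def)
      have "graph_laplacian q K m (\<lambda>x. a * u x + b * v x) x - (a * f x + b * g x) = a * A + b * B"
        by (simp add: gl A_def B_def algebra_simps)
      moreover have "\<bar>a * A + b * B\<bar> \<le> \<bar>a\<bar> * d + \<bar>b\<bar> * d"
        using AB by (intro order_trans[OF abs_triangle_ineq] add_mono) (simp_all add: abs_mult mult_left_mono)
      moreover have "\<bar>a\<bar> * d + \<bar>b\<bar> * d < (\<bar>a\<bar> + \<bar>b\<bar> + 1) * d"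
        using d by (simp add: algebra_simps)
      moreover have "(\<bar>a\<bar> + \<bar>b\<bar> + 1) * d = e" by (simp add: d_def)
      ultimately show "\<bar>graph_laplacian q K m (\<lambda>x. a * u x + b * v x) x - (a * f x + b * g x)\<bar> < e"
        by linarith
    qed
  qed
  then show ?thesis
    using u v unfolding has_laplacian_def on_gasket_def by (auto intro!: continuous_intros)
qed

text \<open>Carries the functions \<open>g m\<close> along instead of iterating the operator
  \<open>laplacian\<close>, so that linear combinations and compositions with symmetries can be
  formed order by order. The parameter \<open>t\<close> is the tangential derivative of
  \<open>g j\<close>.\<close>

definition jet_chain :: "nat \<Rightarrow> real \<Rightarrow> 3 \<Rightarrow> (nat \<Rightarrow> real^2 \<Rightarrow> real) \<Rightarrow> bool" where
  "jet_chain j t n g \<longleftrightarrow>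
     (\<forall>m\<le>j. has_laplacian q K (g m) (g (Suc m))) \<and> g (Suc j) = (\<lambda>x. 0) \<and>
     (\<forall>m\<le>j. g m (q n) = 0 \<and> has_normal_deriv q (g m) 0 n \<and>
        has_tangential_deriv q (g m) (if m = j then t else 0) n)"

lemma jet_chain_monomial:
  assumes "is_monomial3 q K j n p"
  shows "jet_chain j 1 n (\<lambda>m. (laplacian q K ^^ m) p)"
  unfolding jet_chain_def
proof (intro conjI allI impI)
  fix m assume "m \<le> j"
  then show "has_laplacian q K ((laplacian q K ^^ m) p) ((laplacian q K ^^ Suc m) p)"
    using assms has_laplacian_laplacian[of "(laplacian q K ^^ m) p"]
    unfolding is_monomial3_def funpow.simps(2) o_apply by blast
qed (use assms in \<open>simp_all add: is_monomial3_def del: funpow.simps\<close>)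

lemma jet_chain_lincomb:
  assumes "jet_chain j s n g" and "jet_chain j t n h"
  shows "jet_chain j (a * s + b * t) n (\<lambda>m x. a * g m x + b * h m x)"
proof -
  have nd: "has_normal_deriv q (\<lambda>x. a * g m x + b * h m x) 0 n" if "m \<le> j" for m
  proof -
    have "has_normal_deriv q (g m) 0 n" "has_normal_deriv q (h m) 0 n"
      using assms that by (auto simp: jet_chain_def)
    from tendsto_add[OF tendsto_mult_left[OF this(1)[unfolded has_normal_deriv_def], of a]
        tendsto_mult_left[OF this(2)[unfolded has_normal_deriv_def], of b]]
    show ?thesis unfolding has_normal_deriv_def by (simp add: algebra_simps)
  qed
  have td: "has_tangential_deriv q (\<lambda>x. a * g m x + b * h m x) (if m = j then a * s + b * t else 0) n" if "m \<le> j" for m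
  proof -
    have "has_tangential_deriv q (g m) (if m = j then s else 0) n"
         "has_tangential_deriv q (h m) (if m = j then t else 0) n"
      using assms that by (auto simp: jet_chain_def)
    from tendsto_add[OF tendsto_mult_left[OF this(1)[unfolded has_tangential_deriv_def], of a]
        tendsto_mult_left[OF this(2)[unfolded has_tangential_deriv_def], of b]]
    show ?thesis unfolding has_tangential_deriv_def by (cases "m = j") (simp_all add: algebra_simps)
  qed
  have lap: "has_laplacian q K (\<lambda>x. a * g m x + b * h m x) (\<lambda>x. a * g (Suc m) x + b * h (Suc m) x)"
    if "m \<le> j" for m
    using assms that by (intro has_laplacian_lincomb) (simp_all add: jet_chain_def)
  have "a * g m (q n) + b * h m (q n) = 0" if "m \<le> j" for m
    using assms that by (simp add: jet_chain_def)
  moreover have "(\<lambda>x. a * g (Suc j) x + b * h (Suc j) x) = (\<lambda>x. 0)"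
    using assms by (simp add: jet_chain_def)
  ultimately show ?thesis
    using nd td lap unfolding jet_chain_def by blast
qed

text \<open>Downward induction: once \<open>g (Suc m)\<close> is 0, \<open>g m\<close> is harmonic,
  and its vanishing jet at \<open>q n\<close> makes all boundary values vanish. With
  \<open>t = 0\<close> this covers the top order \<open>j\<close> too.\<close>

lemma jet_chain_zero:
  assumes c: "jet_chain j 0 n g" and "m \<le> Suc j"
  shows "g m = (\<lambda>x. 0)"
  using assms(2)
proof (induction rule: inc_induct)
  case base then show ?case using c by (simp add: jet_chain_def)
next
  case (step m)
  have "\<forall>m\<le>j. has_laplacian q K (g m) (g (Suc m))" using c unfolding jet_chain_def by blast
  moreover have m: "m \<le> j" using step by simp
  ultimately have "has_laplacian q K (g m) (g (Suc m))" by blast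
  then have l: "has_laplacian q K (g m) (\<lambda>x. 0)" using step by simp
  show ?case
  proof (rule dirichlet_unique[OF l])
    show "g m (q i) = 0" for i
      by (rule harmonic_jet_zero[OF has_laplacian_0_harmonic[OF l], of n])
        (use c m in \<open>simp_all add: jet_chain_def\<close>)
  qed
qed

lemma jet_chain_unique:
  assumes "jet_chain j t n g" "jet_chain j t n h" "m \<le> Suc j"
  shows "g m = h m"
proof -
  have "jet_chain j 0 n (\<lambda>m x. 1 * g m x + (-1) * h m x)"
    using jet_chain_lincomb[OF assms(1,2), of 1 "-1"] by simp
  from jet_chain_zero[OF this assms(3)] show ?thesis by (simp add: fun_eq_iff)
qed


subsection \<open>Symmetries\<close>

text \<open>The affine map sending each \<open>q i\<close> to \<open>q (\<pi> i)\<close>;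
  barycentric coordinates treat rotations and reflections uniformly.\<close>

definition symmetry :: "(3 \<Rightarrow> 3) \<Rightarrow> real^2 \<Rightarrow> real^2" where
  "symmetry \<pi> x = (\<Sum>i\<in>UNIV. \<beta> i x *\<^sub>R q (\<pi> i))"

lemma bary_symmetry:
  assumes "bij \<pi>" shows "\<beta> (\<pi> i) (symmetry \<pi> x) = \<beta> i x"
proof -
  have "\<beta> (\<pi> i) (symmetry \<pi> x) = (\<Sum>k\<in>UNIV. \<beta> k x * (if i = k then 1 else 0))"
    unfolding symmetry_def using bary_combination[of "\<lambda>i. \<beta> i x" "\<pi> i" "\<lambda>i. q (\<pi> i)", OF bary_sum]
    by (simp add: bary_q inj_eq[OF bij_is_inj[OF assms]])
  then show ?thesis by (simp add: if_distrib[of "(*) _"] cong: if_cong)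
qed

lemma symmetry_eqI:
  assumes "bij \<pi>" "\<And>i. \<beta> (\<pi> i) y = \<beta> i x"
  shows "symmetry \<pi> x = y"
proof (rule bary_eqI)
  fix k
  obtain i where "k = \<pi> i" using bij_is_surj[OF assms(1)] by (metis surjD)
  then show "\<beta> k (symmetry \<pi> x) = \<beta> k y" using assms(2)[of i] bary_symmetry[OF assms(1), of i x] by metis
qed

lemma symmetry_q [simp]: "bij \<pi> \<Longrightarrow> symmetry \<pi> (q i) = q (\<pi> i)"
  by (rule symmetry_eqI) (auto simp: bary_q dest: bij_is_inj inj_eq)

text \<open>Both sides have the same barycentric coordinates. This relation carries words, vertices
  and neighbours to their permuted counterparts.\<close>

lemma symmetry_F: "bij \<pi> \<Longrightarrow> symmetry \<pi> (F i x) = F (\<pi> i) (symmetry \<pi> x)"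
  by (rule symmetry_eqI) (auto simp: bary_contr bary_symmetry dest: bij_is_inj inj_eq)

lemma symmetry_inverse:
  assumes "bij \<pi>" shows "symmetry (inv \<pi>) (symmetry \<pi> x) = x"
proof (rule symmetry_eqI[OF bij_imp_bij_inv[OF assms]])
  fix k
  show "\<beta> (inv \<pi> k) x = \<beta> k (symmetry \<pi> x)"
    using bary_symmetry[OF assms, of "inv \<pi> k" x] surj_f_inv_f[OF bij_is_surj[OF assms], of k] by metis
qed

lemma inj_symmetry: "bij \<pi> \<Longrightarrow> inj (symmetry \<pi>)"
  by (metis symmetry_inverse injI)

lemma continuous_symmetry: "continuous_on S (symmetry \<pi>)"
  unfolding symmetry_def by (intro continuous_intros continuous_bary)

lemma symmetry_Fw: "bij \<pi> \<Longrightarrow> symmetry \<pi> (Fw w x) = Fw (map \<pi> w) (symmetry \<pi> x)"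
  by (induction w) (simp_all add: symmetry_F)

lemma symmetry_funpow: "bij \<pi> \<Longrightarrow> symmetry \<pi> ((F i ^^ m) x) = (F (\<pi> i) ^^ m) (symmetry \<pi> x)"
  by (induction m) (simp_all add: symmetry_F)

lemma symmetry_V: "bij \<pi> \<Longrightarrow> x \<in> V m \<Longrightarrow> symmetry \<pi> x \<in> V m"
proof (induction m arbitrary: x)
  case 0 then show ?case by auto
next
  case (Suc m)
  then obtain i v where v: "x = F i v" "v \<in> V m" by auto
  then have "F (\<pi> i) (symmetry \<pi> v) \<in> V (Suc m)" using Suc unfolding vertices.simps(2) by blast
  then show ?case using v symmetry_F[OF Suc.prems(1)] by simp
qed

text \<open>Interior vertices are dense in \<open>K\<close> and go to vertices, which lie in the
  closed set \<open>K\<close>.\<close>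

lemma symmetry_K:
  assumes "bij \<pi>" "x \<in> K" shows "symmetry \<pi> x \<in> K"
proof -
  have "symmetry \<pi> x \<in> closure K"
    unfolding closure_approachable
  proof (intro allI impI)
    fix e :: real assume "e > 0"
    then obtain d where d: "d > 0" "\<And>y. dist y x < d \<Longrightarrow> dist (symmetry \<pi> y) (symmetry \<pi> x) < e"
      using continuous_symmetry[of UNIV \<pi>] unfolding continuous_on_iff by blast
    obtain m y where y: "y \<in> V m - V 0" "dist x y < d" using interior_dense[OF assms(2) d(1)] .
    have "symmetry \<pi> y \<in> K" using symmetry_V[OF assms(1)] V_in_K y(1) by blast
    moreover have "dist (symmetry \<pi> y) (symmetry \<pi> x) < e" using d(2)[of y] y(2) by (simp add: dist_commute)
    ultimately show "\<exists>y\<in>K. dist y (symmetry \<pi> x) < e" by blast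
  qed
  then show ?thesis using closure_closed[OF compact_imp_closed[OF compact_K]] by simp
qed

lemma symmetry_iff:
  assumes "bij \<pi>"
  shows "symmetry \<pi> x \<in> K \<longleftrightarrow> x \<in> K" and "symmetry \<pi> x \<in> V m \<longleftrightarrow> x \<in> V m"
  using symmetry_K[OF assms, of x] symmetry_K[OF bij_imp_bij_inv[OF assms], of "symmetry \<pi> x"]
    symmetry_V[OF assms, of x m] symmetry_V[OF bij_imp_bij_inv[OF assms], of "symmetry \<pi> x" m]
  unfolding symmetry_inverse[OF assms] by blast+

lemma symmetry_neighbours_subset:
  assumes "bij \<pi>" "y \<in> neighbours q K m x"
  shows "symmetry \<pi> y \<in> neighbours q K m (symmetry \<pi> x)"
proof -
  obtain w a b where "length w = m" "a \<noteq> b" "x = Fw w (q a)" "y = Fw w (q b)"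
    using assms(2) unfolding neighbours_iff by blast
  then have "length (map \<pi> w) = m" "\<pi> a \<noteq> \<pi> b" "symmetry \<pi> x = Fw (map \<pi> w) (q (\<pi> a))"
      "symmetry \<pi> y = Fw (map \<pi> w) (q (\<pi> b))"
    using assms(1) by (auto simp: symmetry_Fw dest: bij_is_inj inj_eq)
  then show ?thesis unfolding neighbours_iff by blast
qed

lemma symmetry_neighbours:
  assumes "bij \<pi>"
  shows "neighbours q K m (symmetry \<pi> x) = symmetry \<pi> ` neighbours q K m x"
proof
  show "symmetry \<pi> ` neighbours q K m x \<subseteq> neighbours q K m (symmetry \<pi> x)"
    using symmetry_neighbours_subset[OF assms] by blast
  show "neighbours q K m (symmetry \<pi> x) \<subseteq> symmetry \<pi> ` neighbours q K m x"
  proof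
    fix y assume "y \<in> neighbours q K m (symmetry \<pi> x)"
    from symmetry_neighbours_subset[OF bij_imp_bij_inv[OF assms] this]
    have "symmetry (inv \<pi>) y \<in> neighbours q K m x" by (simp add: symmetry_inverse[OF assms])
    moreover have "symmetry \<pi> (symmetry (inv \<pi>) y) = y"
      using symmetry_inverse[OF bij_imp_bij_inv[OF assms], of y] by (simp add: inv_inv_eq[OF assms])
    ultimately show "y \<in> symmetry \<pi> ` neighbours q K m x" by (metis imageI)
  qed
qed

lemma graph_laplacian_symmetry:
  assumes "bij \<pi>"
  shows "graph_laplacian q K m (u \<circ> symmetry \<pi>) x = graph_laplacian q K m u (symmetry \<pi> x)"
  unfolding graph_laplacian_def symmetry_neighbours[OF assms]
  by (simp add: sum.reindex inj_on_subset[OF inj_symmetry[OF assms]])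

lemma has_laplacian_symmetry:
  assumes "bij \<pi>" and u: "has_laplacian q K u f"
  shows "has_laplacian q K (u \<circ> symmetry \<pi>) (f \<circ> symmetry \<pi>)"
proof -
  have "continuous_on K (h \<circ> symmetry \<pi>)" if "continuous_on K h" for h :: "real^2 \<Rightarrow> real"
    using that symmetry_K[OF assms(1)]
    by (intro continuous_on_compose continuous_symmetry) (auto intro: continuous_on_subset)
  moreover have "\<exists>N. \<forall>m\<ge>N. \<forall>x\<in>V m - V 0. \<bar>graph_laplacian q K m (u \<circ> symmetry \<pi>) x - (f \<circ> symmetry \<pi>) x\<bar> < e"
    if "e > 0" for e
  proof -
    obtain N where N: "\<And>m x. m \<ge> N \<Longrightarrow> x \<in> V m - V 0 \<Longrightarrow> \<bar>graph_laplacian q K m u x - f x\<bar> < e"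
      using u \<open>e > 0\<close> unfolding has_laplacian_def by blast
    show ?thesis
    proof (intro exI[of _ N] allI impI ballI)
      fix m x assume "m \<ge> N" "x \<in> V m - V 0"
      then have "symmetry \<pi> x \<in> V m - V 0" using symmetry_iff(2)[OF assms(1)] by blast
      then show "\<bar>graph_laplacian q K m (u \<circ> symmetry \<pi>) x - (f \<circ> symmetry \<pi>) x\<bar> < e"
        using N[OF \<open>m \<ge> N\<close>, of "symmetry \<pi> x"] by (simp only: graph_laplacian_symmetry[OF assms(1)] o_apply)
    qed
  qed
  moreover have "on_gasket K (h \<circ> symmetry \<pi>)" if "on_gasket K h" for h
    using that symmetry_iff(1)[OF assms(1)] by (auto simp: on_gasket_def)
  ultimately show ?thesis using u unfolding has_laplacian_def by blast
qed

lemma bij_rotation: "bij (\<lambda>i :: 3. i + 1)"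
  by (rule bijI') (auto intro: exI[of _ "_ - 1"] simp: algebra_simps)

text \<open>For each \<open>c\<close> this is a transposition: modulo 3 exactly one index solves
  \<open>i + i = c\<close> and stays fixed.\<close>

lemma bij_reflection: "bij (\<lambda>i :: 3. c - i)"
  by (rule bijI') (auto intro: exI[of _ "c - _"])

text \<open>A rotation keeps the cyclic order of the vertices, hence the sign of the tangential
  derivative.\<close>

lemma jet_chain_rotation:
  assumes "jet_chain j t (n + 1) g"
  shows "jet_chain j t n (\<lambda>m. g m \<circ> symmetry (\<lambda>i. i + 1))"
proof -
  have "g m (q (n + 1)) = 0" "has_normal_deriv q (g m) 0 (n + 1)"
    "has_tangential_deriv q (g m) (if m = j then t else 0) (n + 1)" if "m \<le> j" for m
    using assms that by (auto simp: jet_chain_def)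
  moreover have "has_laplacian q K (g m \<circ> symmetry (\<lambda>i. i + 1)) (g (Suc m) \<circ> symmetry (\<lambda>i. i + 1))" if "m \<le> j" for m
    using assms that by (intro has_laplacian_symmetry bij_rotation) (simp add: jet_chain_def)
  moreover have "g (Suc j) \<circ> symmetry (\<lambda>i. i + 1) = (\<lambda>x. 0)"
    using assms by (simp add: jet_chain_def fun_eq_iff)
  moreover have "n - 1 + 1 = n + 1 - 1" for n :: 3 by simp
  ultimately show ?thesis
    unfolding jet_chain_def has_normal_deriv_def has_tangential_deriv_def
    by (simp add: symmetry_funpow[OF bij_rotation] symmetry_q[OF bij_rotation])
qed

text \<open>A reflection exchanges the roles of the next and the previous vertex: the normal
  derivative is symmetric in them, the tangential one antisymmetric.\<close>

lemma jet_chain_reflection: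
  assumes "jet_chain j t (c - n) g"
  shows "jet_chain j (- t) n (\<lambda>m. g m \<circ> symmetry (\<lambda>i. c - i))"
proof -
  have g: "g m (q (c - n)) = 0" "has_normal_deriv q (g m) 0 (c - n)"
    "has_tangential_deriv q (g m) (if m = j then t else 0) (c - n)" if "m \<le> j" for m
    using assms that by (auto simp: jet_chain_def)
  have idx: "c - (n + 1) = c - n - 1" "c - (n - 1) = c - n + 1" by simp_all
  have "has_laplacian q K (g m \<circ> symmetry (\<lambda>i. c - i)) (g (Suc m) \<circ> symmetry (\<lambda>i. c - i))" if "m \<le> j" for m
    using assms that by (intro has_laplacian_symmetry bij_reflection) (simp add: jet_chain_def)
  moreover have "g (Suc j) \<circ> symmetry (\<lambda>i. c - i) = (\<lambda>x. 0)"
    using assms by (simp add: jet_chain_def fun_eq_iff)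
  moreover have "has_normal_deriv q (g m \<circ> symmetry (\<lambda>i. c - i)) 0 n" if "m \<le> j" for m
  proof -
    have "2 * (g m \<circ> symmetry (\<lambda>i. c - i)) (q n) - (g m \<circ> symmetry (\<lambda>i. c - i)) ((F n ^^ l) (q (n + 1)))
        - (g m \<circ> symmetry (\<lambda>i. c - i)) ((F n ^^ l) (q (n - 1))) =
      2 * g m (q (c - n)) - g m ((F (c - n) ^^ l) (q (c - n + 1))) - g m ((F (c - n) ^^ l) (q (c - n - 1)))" for l
      by (simp only: o_apply symmetry_funpow[OF bij_reflection] symmetry_q[OF bij_reflection] idx)
    then show ?thesis using g(2)[OF that] unfolding has_normal_deriv_def by (simp only:)
  qed
  moreover have "has_tangential_deriv q (g m \<circ> symmetry (\<lambda>i. c - i)) (if m = j then - t else 0) n" if "m \<le> j" for m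
    using tendsto_minus[OF g(3)[OF that, unfolded has_tangential_deriv_def]] unfolding has_tangential_deriv_def
    by (cases "m = j") (simp_all add: symmetry_funpow[OF bij_reflection] symmetry_q[OF bij_reflection] idx algebra_simps)
  ultimately show ?thesis
    using g(1) unfolding jet_chain_def by (simp add: symmetry_q[OF bij_reflection])
qed

subsection \<open>Integration on the gasket\<close>

context
  fixes \<mu> :: "(real^2) measure"
  assumes gasket_measure: "is_gasket_measure q K \<mu>"
begin

lemma sets_mu: "sets \<mu> = sets (restrict_space borel K)"
  using gasket_measure by (simp add: is_gasket_measure_def)

lemma space_mu: "space \<mu> = K"
  using sets_eq_imp_space_eq[OF sets_mu] by (simp add: space_restrict_space)

lemma measure_cell: "measure \<mu> (Fw w ` K) = (1/3) ^ length w"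
  using gasket_measure by (simp add: is_gasket_measure_def)

lemma finite_measure_mu: "finite_measure \<mu>"
  using gasket_measure by (intro finite_measureI) (simp add: is_gasket_measure_def)

lemma measure_K: "measure \<mu> K = 1"
  using measure_cell[of "[]"] by simp

lemma measure_space_mu: "measure \<mu> (space \<mu>) = 1"
  by (simp add: space_mu measure_K)

lemma integral_const: "(\<integral>x. c \<partial>\<mu>) = (c :: real)"
  by (simp add: measure_space_mu)

lemma measurable_continuous: "continuous_on K f \<Longrightarrow> (f :: real^2 \<Rightarrow> real) \<in> borel_measurable \<mu>"
  unfolding measurable_cong_sets[OF sets_mu refl] by (rule borel_measurable_continuous_on_restrict)

lemma integrable_continuous:
  assumes "continuous_on K f" shows "integrable \<mu> (f :: real^2 \<Rightarrow> real)"
proof -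
  obtain B where "\<And>x. x \<in> K \<Longrightarrow> norm (f x) \<le> B"
    using compact_imp_bounded[OF compact_continuous_image[OF assms compact_K]]
    by (auto simp: bounded_iff)
  then have "AE x in \<mu>. norm (f x) \<le> B" by (intro AE_I2) (simp add: space_mu)
  then show ?thesis
    by (rule finite_measure.integrable_const_bound[OF finite_measure_mu _ measurable_continuous[OF assms]])
qed

lemma continuous_Fw: "continuous_on S (Fw w)"
proof (induction w)
  case (Cons i w)
  have "Fw (i # w) = (\<lambda>x. (1/2) *\<^sub>R (Fw w x - q i) + q i)"
    by (simp add: fun_eq_iff contr_def)
  then show ?case by (simp only:) (intro continuous_intros Cons.IH)
qed simp

lemma cell_measurable: "Fw w ` K \<in> sets \<mu>"
proof -
  have "closed (Fw w ` K)"
    by (intro compact_imp_closed compact_continuous_image continuous_Fw compact_K)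
  then have "Fw w ` K \<in> sets borel" by (rule borel_closed)
  moreover have "K \<inter> (Fw w ` K) = Fw w ` K" using Fw_in_K by blast
  ultimately show ?thesis unfolding sets_mu sets_restrict_space by (metis imageI)
qed

definition words :: "nat \<Rightarrow> 3 list set" where
  "words m = {w. length w = m}"

lemma finite_words: "finite (words m)" and card_words: "card (words m) = 3 ^ m"
  using finite_lists_length_eq[of "UNIV :: 3 set" m] card_lists_length_eq[of "UNIV :: 3 set" m]
  by (simp_all add: words_def)

lemma cell_Int_space [simp]: "Fw w ` K \<inter> space \<mu> = Fw w ` K"
  using space_mu Fw_in_K by blast

lemma integrable_cell: "integrable \<mu> (indicator (Fw w ` K) :: _ \<Rightarrow> real)"
  using finite_measure.emeasure_finite[OF finite_measure_mu]
  by (intro integrable_real_indicator cell_measurable) (simp add: less_top)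

text \<open>The cells of level \<open>m\<close> cover \<open>K\<close> and their masses add up to 1, so their overlaps are null.\<close>

lemma cells_disjoint_AE: "AE x in \<mu>. (\<Sum>w\<in>words m. indicator (Fw w ` K) x) = (1 :: real)"
proof -
  let ?h = "\<lambda>x. (\<Sum>w\<in>words m. indicator (Fw w ` K) x) - (1 :: real)"
  have int: "integrable \<mu> ?h"
    using integrable_cell finite_measure.integrable_const[OF finite_measure_mu]
    by (intro Bochner_Integration.integrable_diff Bochner_Integration.integrable_sum)
  have "?h x \<ge> 0" if "x \<in> K" for x
  proof -
    obtain w where w: "w \<in> words m" "x \<in> Fw w ` K" using cells_cover[OF \<open>x \<in> K\<close>, of m] unfolding words_def by blast
    have "indicator (Fw w ` K) x \<le> (\<Sum>w\<in>words m. indicator (Fw w ` K) x :: real)"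
      by (rule member_le_sum[OF w(1) _ finite_words]) simp
    then show ?thesis using w by simp
  qed
  then have nn: "AE x in \<mu>. 0 \<le> ?h x" by (intro AE_I2) (simp add: space_mu)
  have "integral\<^sup>L \<mu> ?h = (\<integral>x. (\<Sum>w\<in>words m. indicator (Fw w ` K) x) \<partial>\<mu>) - (\<integral>x. 1 \<partial>\<mu>)"
    by (intro Bochner_Integration.integral_diff Bochner_Integration.integrable_sum integrable_cell
      finite_measure.integrable_const[OF finite_measure_mu])
  also have "\<dots> = (\<Sum>w\<in>words m. (1/3) ^ length w) - 1"
    by (simp add: Bochner_Integration.integral_sum integrable_cell measure_cell measure_space_mu)
  also have "\<dots> = (\<Sum>w\<in>words m. (1/3) ^ m) - 1" by (simp add: words_def)
  also have "\<dots> = 0" by (simp add: card_words power_divide)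
  finally show ?thesis using integral_nonneg_eq_0_iff_AE[OF int nn] by simp
qed

text \<open>By uniform continuity \<open>f\<close> is close, on each small cell, to its value at one
  corner, and the sum is the integral of the resulting step function. The corner index
  \<open>k\<close> is left free so that the sample points can be changed later.\<close>

lemma riemann_sums:
  fixes f :: "real^2 \<Rightarrow> real"
  assumes f: "continuous_on K f"
  shows "(\<lambda>m. (1/3) ^ m * (\<Sum>w\<in>words m. f (Fw w (q k)))) \<longlonglongrightarrow> (\<integral>x. f x \<partial>\<mu>)"
proof (rule LIMSEQ_I)
  fix r :: real assume "r > 0"
  then have e: "r / 2 > 0" by simp
  obtain d where d: "d > 0" "\<And>x y. x \<in> K \<Longrightarrow> y \<in> K \<Longrightarrow> dist y x < d \<Longrightarrow> dist (f y) (f x) < r / 2"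
    using compact_uniformly_continuous[OF f compact_K] e unfolding uniformly_continuous_on_def by metis
  obtain M where M: "\<And>w x y. length w \<ge> M \<Longrightarrow> x \<in> Fw w ` K \<Longrightarrow> y \<in> Fw w ` K \<Longrightarrow> dist x y < d"
    using cells_small[OF d(1)] by blast
  show "\<exists>M. \<forall>m\<ge>M. norm ((1/3) ^ m * (\<Sum>w\<in>words m. f (Fw w (q k))) - (\<integral>x. f x \<partial>\<mu>)) < r"
  proof (intro exI[of _ M] allI impI)
    fix m assume m: "m \<ge> M"
    \<comment> \<open>A point in several cells is counted several times here, but such points form a
      null set.\<close>
    let ?s = "\<lambda>x. \<Sum>w\<in>words m. f (Fw w (q k)) * indicator (Fw w ` K) x"
    have s: "integrable \<mu> ?s"
      by (intro Bochner_Integration.integrable_sum integrable_mult_right integrable_cell)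
    have ints: "integral\<^sup>L \<mu> ?s = (1/3) ^ m * (\<Sum>w\<in>words m. f (Fw w (q k)))"
    proof -
      have "integral\<^sup>L \<mu> ?s = (\<Sum>w\<in>words m. f (Fw w (q k)) * (1/3) ^ length w)"
        by (simp add: Bochner_Integration.integral_sum integrable_cell measure_cell)
      also have "\<dots> = (\<Sum>w\<in>words m. f (Fw w (q k)) * (1/3) ^ m)" by (simp add: words_def)
      also have "\<dots> = (1/3) ^ m * (\<Sum>w\<in>words m. f (Fw w (q k)))"
        unfolding sum_distrib_left by (simp only: mult.commute)
      finally show ?thesis .
    qed
    have diff: "AE x in \<mu>. norm (?s x - f x) \<le> r / 2"
      using cells_disjoint_AE[of m] AE_space
    proof eventually_elim
      case (elim x)
      \<comment> \<open>Almost everywhere the indicators add up to 1, so \<open>f x\<close> can be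
        moved under the sum.\<close>
      have "?s x - f x = ?s x - f x * (\<Sum>w\<in>words m. indicator (Fw w ` K) x)" using elim(1) by simp
      also have "\<dots> = (\<Sum>w\<in>words m. (f (Fw w (q k)) - f x) * indicator (Fw w ` K) x)"
        unfolding sum_distrib_left sum_subtractf[symmetric] by (simp only: left_diff_distrib)
      finally have "norm (?s x - f x) \<le> (\<Sum>w\<in>words m. norm ((f (Fw w (q k)) - f x) * indicator (Fw w ` K) x))"
        by (simp only: norm_sum)
      also have "\<dots> \<le> (\<Sum>w\<in>words m. r / 2 * indicator (Fw w ` K) x)"
      proof (rule sum_mono)
        fix w assume w: "w \<in> words m"
        have "dist (f (Fw w (q k))) (f x) < r / 2" if "x \<in> Fw w ` K"
          using elim(2) m w that
          by (intro d(2) M Fw_in_K q_in_K) (simp_all add: space_mu words_def imageI[OF q_in_K])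
        then show "norm ((f (Fw w (q k)) - f x) * indicator (Fw w ` K) x) \<le> r / 2 * indicator (Fw w ` K) x"
          by (auto simp: indicator_def dist_norm)
      qed
      also have "\<dots> = r / 2" unfolding sum_distrib_left[symmetric] using elim(1) by simp
      finally show ?case .
    qed
    have fi: "integrable \<mu> f" by (rule integrable_continuous[OF f])
    have "norm (integral\<^sup>L \<mu> ?s - integral\<^sup>L \<mu> f) = norm (\<integral>x. ?s x - f x \<partial>\<mu>)"
      by (simp only: Bochner_Integration.integral_diff[OF s fi])
    also have "\<dots> \<le> (\<integral>x. r / 2 \<partial>\<mu>)"
      using Bochner_Integration.integrable_diff[OF s fi] diff finite_measure.integrable_const[OF finite_measure_mu]
      by (intro order_trans[OF integral_norm_bound] integral_mono_AE integrable_norm)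
    also have "\<dots> = r / 2" by (rule integral_const)
    finally show "norm ((1/3) ^ m * (\<Sum>w\<in>words m. f (Fw w (q k))) - integral\<^sup>L \<mu> f) < r"
      using \<open>r > 0\<close> by (simp only: ints)
  qed
qed

text \<open>The measure is only known on cells, so its invariance is read off from Riemann sums.\<close>

lemma integral_symmetry:
  fixes f :: "real^2 \<Rightarrow> real"
  assumes \<pi>: "bij \<pi>" and f: "continuous_on K f"
  shows "(\<integral>x. f (symmetry \<pi> x) \<partial>\<mu>) = (\<integral>x. f x \<partial>\<mu>)"
proof -
  have "continuous_on K (f \<circ> symmetry \<pi>)"
    using f symmetry_K[OF \<pi>] by (intro continuous_on_compose continuous_symmetry) (auto intro: continuous_on_subset)
  then have 1: "(\<lambda>m. (1/3) ^ m * (\<Sum>w\<in>words m. f (symmetry \<pi> (Fw w (q 0))))) \<longlonglongrightarrow> (\<integral>x. f (symmetry \<pi> x) \<partial>\<mu>)"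
    using riemann_sums[of "f \<circ> symmetry \<pi>" 0] by simp
  have bij: "bij_betw (map \<pi>) (words m) (words m)" for m
  proof (rule bij_betwI[where g = "map (inv \<pi>)"])
    show "map \<pi> \<in> words m \<rightarrow> words m" "map (inv \<pi>) \<in> words m \<rightarrow> words m" by (auto simp: words_def)
    show "map (inv \<pi>) (map \<pi> w) = w" for w
      by (simp add: inv_o_cancel[OF bij_is_inj[OF \<pi>]])
    show "map \<pi> (map (inv \<pi>) w) = w" for w
      by (simp add: surj_iff[THEN iffD1, OF bij_is_surj[OF \<pi>]])
  qed
  \<comment> \<open>The symmetry permutes the cells but moves the sample corner from
    \<open>q 0\<close> to \<open>q (\<pi> 0)\<close>; the limit is the same for every
    corner.\<close>
  have "(\<Sum>w\<in>words m. f (symmetry \<pi> (Fw w (q 0)))) = (\<Sum>w\<in>words m. f (Fw w (q (\<pi> 0))))" for m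
    using sum.reindex_bij_betw[OF bij, of "\<lambda>w. f (Fw w (q (\<pi> 0)))" m] by (simp add: symmetry_Fw[OF \<pi>] symmetry_q[OF \<pi>])
  then show ?thesis using LIMSEQ_unique[OF 1] riemann_sums[OF f, of "\<pi> 0"] by simp
qed

text \<open>A nonzero value at \<open>x\<close> persists on a small cell containing
  \<open>x\<close>, and every cell has positive mass.\<close>

lemma AE_zero_imp_zero:
  fixes f :: "real^2 \<Rightarrow> real"
  assumes f: "continuous_on K f" and ae: "AE x in \<mu>. f x = 0" and x: "x \<in> K"
  shows "f x = 0"
proof (rule ccontr)
  assume "f x \<noteq> 0"
  then have "\<bar>f x\<bar> > 0" by simp
  then obtain d where d: "d > 0" "\<And>y. y \<in> K \<Longrightarrow> dist y x < d \<Longrightarrow> dist (f y) (f x) < \<bar>f x\<bar>"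
    using f x unfolding continuous_on_iff by blast
  obtain M where M: "\<And>w x y. length w \<ge> M \<Longrightarrow> x \<in> Fw w ` K \<Longrightarrow> y \<in> Fw w ` K \<Longrightarrow> dist x y < d"
    using cells_small[OF d(1)] by blast
  obtain w where w: "length w = M" "x \<in> Fw w ` K" using cells_cover[OF x] by blast
  have "f y \<noteq> 0" if "y \<in> Fw w ` K" for y
    using d(2)[of y] M[of w y x] w that Fw_in_K by (auto simp: dist_norm)
  then have "AE y in \<mu>. y \<notin> Fw w ` K" using ae by (auto elim: eventually_mono)
  then have "Fw w ` K \<in> null_sets \<mu>" using AE_iff_null_sets[OF cell_measurable] by blast
  then have "measure \<mu> (Fw w ` K) = 0" by (simp add: measure_def null_setsD1)
  then show False by (simp add: measure_cell)
qed

end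

subsection \<open>The three monomials\<close>

context
  fixes j :: nat and P :: "3 \<Rightarrow> real^2 \<Rightarrow> real"
  assumes P: "\<And>n. is_monomial3 q K j n (P n)"
begin

definition iter_lap :: "3 \<Rightarrow> nat \<Rightarrow> real^2 \<Rightarrow> real" where
  "iter_lap n m = (laplacian q K ^^ m) (P n)"

lemma iter_lap_chain: "jet_chain j 1 n (iter_lap n)"
  using jet_chain_monomial[OF P] unfolding iter_lap_def .

text \<open>The rotated chain of \<open>n + 1\<close> has the same jet at \<open>q n\<close> as the
  chain of \<open>n\<close>.\<close>

lemma iter_lap_rotation: "m \<le> Suc j \<Longrightarrow> iter_lap (n + 1) m (symmetry (\<lambda>i. i + 1) x) = iter_lap n m x"
  using jet_chain_unique[OF jet_chain_rotation[OF iter_lap_chain] iter_lap_chain, of m n] by (simp add: fun_eq_iff)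

text \<open>The reflected chain of \<open>c - n\<close> and the negated chain of \<open>n\<close>
  have the same jet at \<open>q n\<close>, with top tangential derivative -1.\<close>

lemma iter_lap_reflection: "m \<le> Suc j \<Longrightarrow> iter_lap (c - n) m (symmetry (\<lambda>i. c - i) x) = - iter_lap n m x"
proof -
  assume m: "m \<le> Suc j"
  \<comment> \<open>Negation is written as a linear combination with second coefficient 0.\<close>
  have "jet_chain j (- 1) n (\<lambda>m x. (- 1) * iter_lap n m x + 0 * iter_lap n m x)"
    using jet_chain_lincomb[OF iter_lap_chain iter_lap_chain, of "- 1" 0] by simp
  from jet_chain_unique[OF jet_chain_reflection[OF iter_lap_chain] this m]
  show ?thesis by (simp add: fun_eq_iff)
qed

text \<open>The Laplacian of the sum is the sum one order up, hence 0 by induction, so only the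
  three boundary values remain to be checked.\<close>

lemma sum_iter_lap_zero: "m \<le> Suc j \<Longrightarrow> (\<lambda>x. \<Sum>n\<in>UNIV. iter_lap n m x) = (\<lambda>x. 0)"
proof (induction rule: inc_induct)
  case base then show ?case using iter_lap_chain by (simp add: jet_chain_def)
next
  case (step m)
  have m: "m \<le> j" using step by simp
  then have "has_laplacian q K (iter_lap n m) (iter_lap n (Suc m))" for n
    using iter_lap_chain by (simp add: jet_chain_def)
  then have "has_laplacian q K (\<lambda>x. 1 * (1 * iter_lap 0 m x + 1 * iter_lap 1 m x) + 1 * iter_lap 2 m x)
      (\<lambda>x. 1 * (1 * iter_lap 0 (Suc m) x + 1 * iter_lap 1 (Suc m) x) + 1 * iter_lap 2 (Suc m) x)"
    by (intro has_laplacian_lincomb)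
  then have "has_laplacian q K (\<lambda>x. \<Sum>n\<in>UNIV. iter_lap n m x) (\<lambda>x. \<Sum>n\<in>UNIV. iter_lap n (Suc m) x)"
    by (simp add: sum_UNIV_3)
  then have lap: "has_laplacian q K (\<lambda>x. \<Sum>n\<in>UNIV. iter_lap n m x) (\<lambda>x. 0)"
    unfolding step.IH .
  show ?case
  proof (rule dirichlet_unique[OF lap])
    fix i :: 3
    \<comment> \<open>With \<open>c = i + i\<close> the reflection fixes \<open>q i\<close> and
      swaps the other two vertices: the term of \<open>i\<close> vanishes there and the other two
      cancel.\<close>
    have ii: "(i + i) - i = i" by simp
    have "iter_lap (i + i - n) m (q i) = - iter_lap n m (q i)" for n
      using iter_lap_reflection[of m "i + i" n "q i"] m symmetry_q[OF bij_reflection, of "i + i" i] ii by simp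
    from this[of i] this[of "i + 1"]
    have "iter_lap i m (q i) = 0" "iter_lap (i - 1) m (q i) = - iter_lap (i + 1) m (q i)"
      by (simp_all add: algebra_simps)
    then show "(\<Sum>n\<in>UNIV. iter_lap n m (q i)) = 0"
      unfolding sum_UNIV_3_cyclic[of _ i] by simp
  qed
qed

lemma P_rotation: "P (n + 1) (symmetry (\<lambda>i. i + 1) x) = P n x"
  using iter_lap_rotation[of 0] by (simp add: iter_lap_def)

lemma sum_P: "P 0 x + P 1 x + P 2 x = 0"
  using sum_iter_lap_zero[of 0] by (simp add: iter_lap_def fun_eq_iff sum_UNIV_3)

lemma continuous_P: "continuous_on K (P n)"
  using P[of n] by (auto simp: is_monomial3_def in_dom_laplacian_def has_laplacian_def)

lemma P_off_K: "x \<notin> K \<Longrightarrow> P n x = 0"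
  using P[of n] by (auto simp: is_monomial3_def in_dom_laplacian_def has_laplacian_def on_gasket_def)

text \<open>If \<open>P n\<close> were 0, so would be its iterated Laplacians, against the
  tangential derivative 1 at order \<open>j\<close>.\<close>

lemma P_nonzero: "P n \<noteq> (\<lambda>x. 0)"
proof
  assume 0: "P n = (\<lambda>x. 0)"
  have "iter_lap n m = (\<lambda>x. 0)" if "m \<le> j" for m
    using that
  proof (induction m)
    case (Suc m)
    then have "has_laplacian q K (\<lambda>x. 0) (iter_lap n (Suc m))"
      using iter_lap_chain[of n] unfolding jet_chain_def by (metis Suc_leD)
    \<comment> \<open>The coefficients 0 show that the zero function has Laplacian 0; by uniqueness
      the next iterate is 0.\<close>
    from has_laplacian_lincomb[OF this this, of 0 0] this show ?case
      by (simp add: has_laplacian_unique)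
  qed (simp add: iter_lap_def 0)
  then have "has_tangential_deriv q (\<lambda>x. 0) 1 n"
    using iter_lap_chain[of n] unfolding jet_chain_def by (metis le_refl)
  then show False by (simp add: has_tangential_deriv_def LIMSEQ_const_iff)
qed


section \<open>Gram matrix, span and frame identity\<close>

context
  fixes \<mu> :: "(real^2) measure"
  assumes gasket_measure: "is_gasket_measure q K \<mu>"
begin

abbreviation ip where "ip \<equiv> l2_inner \<mu>"

lemmas integrable_mu = integrable_continuous[OF gasket_measure]

lemma ip_commute: "ip f g = ip g f"
  by (simp add: l2_inner_def mult.commute)

lemma ip_rotation: "ip (P (n + 1)) (P (m + 1)) = ip (P n) (P m)"
proof -
  have "continuous_on K (\<lambda>x. P (n + 1) x * P (m + 1) x)"
    by (intro continuous_intros continuous_P)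
  from integral_symmetry[OF gasket_measure bij_rotation this]
  show ?thesis by (simp add: l2_inner_def P_rotation)
qed

lemma ip_lincomb:
  assumes "continuous_on K g"
  shows "ip (\<lambda>x. \<Sum>i\<in>(UNIV :: 3 set). a i * P i x) g = (\<Sum>i\<in>UNIV. a i * ip (P i) g)"
proof -
  have "integrable \<mu> (\<lambda>x. P i x * g x)" for i
    by (intro integrable_mu continuous_intros continuous_P assms)
  then show ?thesis
    by (simp add: l2_inner_def sum_distrib_right mult.assoc Bochner_Integration.integral_sum)
qed

text \<open>Rotations make the three norms equal and the mutual inner products equal; pairing the
  zero sum with \<open>P 0\<close> then fixes their ratio.\<close>

lemma gram: "ip (P n) (P m) = (if n = m then ip (P 0) (P 0) else - ip (P 0) (P 0) / 2)"
proof -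
  have diag: "ip (P 1) (P 1) = ip (P 0) (P 0)" "ip (P 2) (P 2) = ip (P 0) (P 0)"
    using ip_rotation[of 0 0] ip_rotation[of 1 1] by simp_all
  have off: "ip (P 1) (P 2) = ip (P 0) (P 1)" "ip (P 2) (P 0) = ip (P 0) (P 1)"
    using ip_rotation[of 0 1] ip_rotation[of 1 2] by (simp_all add: arith_3)
  have "(\<lambda>x. \<Sum>i\<in>UNIV. 1 * P i x) = (\<lambda>x. 0)" by (simp add: sum_UNIV_3 sum_P)
  then have "(\<Sum>i\<in>UNIV. ip (P i) (P 0)) = 0"
    using ip_lincomb[OF continuous_P[of 0], of "\<lambda>_. 1"] by (simp add: l2_inner_def)
  then have "ip (P 0) (P 1) = - ip (P 0) (P 0) / 2"
    using off ip_commute[of "P 1" "P 0"] by (simp add: sum_UNIV_3)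
  then show ?thesis
    using diag off ip_commute[of "P 1" "P 0"] ip_commute[of "P 2" "P 1"] ip_commute[of "P 0" "P 2"]
    by (cases n rule: cases_3; cases m rule: cases_3) simp_all
qed

lemma ip_pos: "0 < ip (P 0) (P 0)"
proof -
  have int: "integrable \<mu> (\<lambda>x. P 0 x * P 0 x)"
    by (intro integrable_mu continuous_intros continuous_P)
  have "0 \<le> ip (P 0) (P 0)" by (simp add: l2_inner_def)
  moreover have "ip (P 0) (P 0) \<noteq> 0"
  proof
    assume "ip (P 0) (P 0) = 0"
    then have "AE x in \<mu>. P 0 x = 0"
      using integral_nonneg_eq_0_iff_AE[OF int] by (simp add: l2_inner_def)
    then have "P 0 x = 0" for x
      using AE_zero_imp_zero[OF gasket_measure continuous_P] P_off_K by blast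
    then show False using P_nonzero[of 0] by (simp add: fun_eq_iff)
  qed
  ultimately show ?thesis by linarith
qed

text \<open>Supplies coefficients for computing with the Gram matrix; they are not unique, since the
  three functions add up to 0.\<close>

lemma span_P: "f \<in> fun_space.span (range P) \<Longrightarrow> \<exists>a. f = (\<lambda>x. \<Sum>i\<in>UNIV. a i * P i x)"
proof -
  let ?S = "range (\<lambda>a x. \<Sum>i\<in>UNIV. a i * P i x)"
  have "P n \<in> ?S" for n
    by (rule image_eqI[of _ _ "\<lambda>i. if i = n then 1 else 0"])
      (simp_all add: fun_eq_iff if_distrib[of "\<lambda>t. t * _"] cong: if_cong)
  moreover have "fun_space.subspace ?S"
    unfolding fun_space.subspace_def
  proof (intro conjI ballI allI)
    show "0 \<in> ?S" by (rule image_eqI[of _ _ "\<lambda>_. 0"]) (simp_all add: fun_eq_iff)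
    fix f assume "f \<in> ?S"
    then obtain a where a: "f = (\<lambda>x. \<Sum>i\<in>UNIV. a i * P i x)" by blast
    show "(\<lambda>x. c * f x) \<in> ?S" for c
      by (rule image_eqI[of _ _ "\<lambda>i. c * a i"]) (simp_all add: a sum_distrib_left mult.assoc)
    fix g assume "g \<in> ?S"
    then obtain b where b: "g = (\<lambda>x. \<Sum>i\<in>UNIV. b i * P i x)" by blast
    show "f + g \<in> ?S"
      by (rule image_eqI[of _ _ "\<lambda>i. a i + b i"])
        (simp_all add: a b fun_eq_iff sum.distrib[symmetric] distrib_right)
  qed
  ultimately have "fun_space.span (range P) \<subseteq> ?S"
    by (intro fun_space.span_minimal) blast+
  then show "\<exists>a. f = (\<lambda>x. \<Sum>i\<in>UNIV. a i * P i x)" if "f \<in> fun_space.span (range P)"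
    using that by blast
qed

text \<open>\<open>P 0\<close> and \<open>P 1\<close> form a basis, as \<open>P 2\<close> is minus
  their sum.\<close>

lemma dim_span_P: "fun_space.dim (fun_space.span (range P)) = 2"
proof -
  have "P 1 \<notin> fun_space.span {P 0}"
  proof
    assume "P 1 \<in> fun_space.span {P 0}"
    then obtain k where k: "P 1 = (\<lambda>x. k * P 0 x)"
      unfolding fun_space.span_singleton by blast
    have "ip (P 1) g = k * ip (P 0) g" for g
      by (simp add: l2_inner_def k mult.assoc)
    \<comment> \<open>Pairing with \<open>P 0\<close> would force \<open>k = -1/2\<close>, pairing
      with \<open>P 1\<close> would force \<open>k = -2\<close>.\<close>
    from this[of "P 0"] this[of "P 1"]
    have *: "- ip (P 0) (P 0) / 2 = k * ip (P 0) (P 0)" "ip (P 0) (P 0) = k * (- ip (P 0) (P 0) / 2)"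
      using gram[of 0 1] gram[of 1 0] gram[of 1 1] by simp_all
    from *(2) have "ip (P 0) (P 0) = - (k * ip (P 0) (P 0)) / 2" by simp
    with *(1) ip_pos show False by linarith
  qed
  moreover have "P 0 \<notin> fun_space.span {}"
    using P_nonzero[of 0] by (simp add: zero_fun_def)
  ultimately have ind: "\<not> fun_space.dependent {P 1, P 0}"
    by (intro fun_space.independent_insertI fun_space.independent_empty)
  have ne: "P 1 \<noteq> P 0" using \<open>P 1 \<notin> fun_space.span {P 0}\<close> fun_space.span_base[of "P 0" "{P 0}"] by auto
  have "P 2 = (\<lambda>x. (-1) * P 0 x) + (\<lambda>x. (-1) * P 1 x)"
  proof
    show "P 2 x = ((\<lambda>x. (-1) * P 0 x) + (\<lambda>x. (-1) * P 1 x)) x" for x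
      using sum_P[of x] by (simp add: plus_fun_def)
  qed
  moreover have "(\<lambda>x. (-1) * P 0 x) + (\<lambda>x. (-1) * P 1 x) \<in> fun_space.span {P 1, P 0}"
    by (intro fun_space.span_add fun_space.span_scale) (rule fun_space.span_base; simp)+
  ultimately have "P 2 \<in> fun_space.span {P 1, P 0}" by (simp only:)
  moreover have "{P 1, P 0} \<subseteq> fun_space.span {P 1, P 0}"
    by (rule fun_space.span_superset)
  ultimately have "range P \<subseteq> fun_space.span {P 1, P 0}"
    unfolding range_3 by blast
  then have "fun_space.span (range P) \<subseteq> fun_space.span {P 1, P 0}"
    by (intro fun_space.span_minimal fun_space.subspace_span)
  moreover have "{P 1, P 0} \<subseteq> fun_space.span (range P)"
    using fun_space.span_superset[of "range P"] by blast
  moreover have "card {P 1, P 0} = 2" using ne by simp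
  ultimately show ?thesis using ind by (intro fun_space.dim_unique)
qed

text \<open>All members of the span are continuous on \<open>K\<close> and vanish off
  \<open>K\<close>, so being null forces them to be 0.\<close>

lemma embeds_span_P: "embeds_in_l2 \<mu> (fun_space.span (range P))"
proof -
  have "continuous_on K f \<and> (\<forall>x. x \<notin> K \<longrightarrow> f x = 0)" if f: "f \<in> fun_space.span (range P)" for f
  proof -
    obtain a where a: "f = (\<lambda>x. \<Sum>i\<in>UNIV. a i * P i x)" using span_P[OF f] by blast
    have "continuous_on K f" unfolding a by (intro continuous_intros continuous_P)
    then show ?thesis by (simp add: a P_off_K)
  qed
  note span = this
  show ?thesis
    unfolding embeds_in_l2_def
  proof (intro conjI ballI impI)
    fix f assume f: "f \<in> fun_space.span (range P)"
    then have c: "continuous_on K f" using span by blast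
    show "f \<in> borel_measurable \<mu>" by (rule measurable_continuous[OF gasket_measure c])
    show "integrable \<mu> (\<lambda>x. (f x)\<^sup>2)" by (intro integrable_mu continuous_intros c)
    assume "AE x in \<mu>. f x = 0"
    then show "f = (\<lambda>x. 0)"
      using AE_zero_imp_zero[OF gasket_measure c] span[OF f] by blast
  qed
qed

lemma tight_frame_P:
  "tight_frame \<mu> P (fun_space.span (range P)) (3/2 * (l2_norm \<mu> (P 0))\<^sup>2)"
proof -
  define N where "N = ip (P 0) (P 0)"
  have N: "(l2_norm \<mu> (P 0))\<^sup>2 = N" using ip_pos by (simp add: l2_norm_def N_def)
  have "(\<Sum>i\<in>UNIV. (ip f (P i))\<^sup>2) = 3/2 * N * (l2_norm \<mu> f)\<^sup>2" if f: "f \<in> fun_space.span (range P)" for f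
  proof -
    obtain a where a: "f = (\<lambda>x. \<Sum>i\<in>UNIV. a i * P i x)" using span_P[OF f] by blast
    have cont: "continuous_on K f" unfolding a by (intro continuous_intros continuous_P)
    have fP: "ip f (P n) = (\<Sum>i\<in>UNIV. a i * ip (P i) (P n))" for n
      unfolding a by (rule ip_lincomb[OF continuous_P])
    have ff: "ip f f = (\<Sum>i\<in>UNIV. a i * ip f (P i))"
      using ip_lincomb[OF cont, of a] by (simp add: a[symmetric] ip_commute[of "P _" f])
    have norm_f: "(l2_norm \<mu> f)\<^sup>2 = ip f f"
      by (simp add: l2_norm_def l2_inner_def)
    have gram_N: "ip (P n) (P m) = (if n = m then N else - N / 2)" for n m
      unfolding N_def by (rule gram)
    \<comment> \<open>Both sides are quadratic forms in \<open>a\<close>. With the Gram matrix G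
      their matrices are G^2 and \<open>3/2 * N\<close> times G, which agree because G is
      \<open>3/2 * N\<close> times a projection.\<close>
    show ?thesis
      unfolding norm_f ff fP gram_N sum_UNIV_3
      by (simp add: field_simps power2_eq_square)
  qed
  moreover have "range P \<subseteq> fun_space.span (range P)" using fun_space.span_base by blast
  moreover have "0 < 3/2 * N" using ip_pos by (simp add: N_def)
  ultimately show ?thesis unfolding tight_frame_def N by blast
qed

end

end

end

theorem theorem4p1:
  fixes q :: "3 \<Rightarrow> real^2" and K :: "(real^2) set" and \<mu> :: "(real^2) measure"
    and j :: nat and P :: "3 \<Rightarrow> real^2 \<Rightarrow> real"
  assumes "equilateral q"
    and "is_gasket q K"
    and "is_gasket_measure q K \<mu>"
    and "\<And>n. is_monomial3 q K j n (P n)"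
  shows "embeds_in_l2 \<mu> (fun_space.span (range P)) \<and>
         fun_space.dim (fun_space.span (range P)) = 2 \<and>
         tight_frame \<mu> P (fun_space.span (range P)) (3/2 * (l2_norm \<mu> (P 0))\<^sup>2)"
proof -
  interpret gasket q K using assms(1,2) by unfold_locales
  show ?thesis
    using embeds_span_P[OF assms(4,3)] dim_span_P[OF assms(4,3)] tight_frame_P[OF assms(4,3)] by blast
qed

end
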